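(* Let $A$ be a Dedekind left brace such that $A=\operatorname{Soc}_2(A)$ and the additive group of $A$ is not periodic. Then there exist left braces $T$ and $D$ such that $A$ embeds (via an injective homomorphism of left braces) into the direct sum $T\oplus D$, where 1. $T$ is a Dedekind left brace whose additive group is periodic; 2. the additive group of $T\ast T$ is locally cyclic; 3. $T\ast T\subseteq\zeta(T)$; 4. $D$ is abelian.
   Context: A left brace is a triple $(A,+,\cdot)$ such that $(A,+)$ is an abelian group, $(A,\cdot)$ is a group, and $a\cdot(b+c)=a\cdot b+a\cdot c-a$ for all $a,b,c\in A$. The two groups have the same identity $0$. The star operation is $a\ast b=ab-a-b$. For subsets $X,Y\subseteq A$, $X\ast Y$ denotes the subgroup of $(A,+)$ generated by all $x\ast y$ with $x\in X$, $y\in Y$. $A$ is abelian if $a\ast b=0$ for all $a,b\in A$. A non-empty subset is a subbrace if it is a subgroup for both operations; a subbrace $I$ is an ideal of $A$ if $A\ast I\subseteq I$ and $I\ast A\subseteq I$ (then $A/I$ is a left brace). $A$ is Dedekind if every subbrace of $A$ is an ideal of $A$. The direct sum $T\oplus D$ is the cartesian product with componentwise sum and product; homomorphisms of left braces preserve both sums and products. The socle is the ideal $\operatorname{Soc}(A)=\{a\in A\mid a\ast x=0 \text{ for all } x\in A\}$, and $\operatorname{Soc}_2(A)$ is the ideal containing $\operatorname{Soc}(A)$ with $\operatorname{Soc}_2(A)/\operatorname{Soc}(A)=\operatorname{Soc}(A/\operatorname{Soc}(A))$. The centre is $\zeta(A)=\{a\in A\mid ax=a+x=xa \text{ for all } x\in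 A\}$. A group is periodic if all its elements have finite order, and locally cyclic if every finitely generated subgroup is cyclic. *)

theory Defs
  imports "HOL-Algebra.Chinese_Remainder" "HOL-Algebra.Elementary_Groups"
begin

text \<open>A left brace is carried by the record type \<^typ>\<open>'a ring\<close>, which is used only as a
  signature with two operations: no ring axiom beyond the two group structures is assumed.
  This makes the library notions \<^const>\<open>add_monoid\<close>, \<^const>\<open>FactRing\<close> and
  \<^const>\<open>RDirProd\<close> available.\<close>

locale left_brace = abelian_group A + group A for A (structure) +
  assumes brace_distr:
    "\<lbrakk> a \<in> carrier A; b \<in> carrier A; c \<in> carrier A \<rbrakk>
      \<Longrightarrow> a \<otimes> (b \<oplus> c) = ((a \<otimes> b) \<oplus> (a \<otimes> c)) \<ominus> a"

lemma (in left_brace) zero_eq_one: "\<zero> = \<one>"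
proof -
  have "\<one> \<otimes> (\<zero> \<oplus> \<zero>) = ((\<one> \<otimes> \<zero>) \<oplus> (\<one> \<otimes> \<zero>)) \<ominus> \<one>"
    by (rule brace_distr) simp_all
  then have "\<zero> = \<ominus> \<one>"
    by (simp add: a_minus_def)
  moreover have "\<one> \<oplus> \<ominus> \<one> = \<zero>"
    by (rule r_neg) simp
  ultimately have "\<one> \<oplus> \<zero> = \<zero>"
    by (rule ssubst)
  then show ?thesis
    by simp
qed

definition star :: "('a, 'm) ring_scheme \<Rightarrow> 'a \<Rightarrow> 'a \<Rightarrow> 'a" where
  "star A a b = ((a \<otimes>\<^bsub>A\<^esub> b) \<ominus>\<^bsub>A\<^esub> a) \<ominus>\<^bsub>A\<^esub> b"

definition star_set :: "('a, 'm) ring_scheme \<Rightarrow> 'a set \<Rightarrow> 'a set \<Rightarrow> 'a set" where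
  "star_set A U V = generate (add_monoid A) {star A x y | x y. x \<in> U \<and> y \<in> V}"

definition abelian_brace :: "('a, 'm) ring_scheme \<Rightarrow> bool" where
  "abelian_brace A \<longleftrightarrow>
     left_brace A \<and> (\<forall>a \<in> carrier A. \<forall>b \<in> carrier A. star A a b = \<zero>\<^bsub>A\<^esub>)"

definition subbrace :: "'a set \<Rightarrow> ('a, 'm) ring_scheme \<Rightarrow> bool" where
  "subbrace S A \<longleftrightarrow> subgroup S (add_monoid A) \<and> subgroup S A"

definition brace_ideal :: "'a set \<Rightarrow> ('a, 'm) ring_scheme \<Rightarrow> bool" where
  "brace_ideal I A \<longleftrightarrow>
     subbrace I A \<and> star_set A (carrier A) I \<subseteq> I \<and> star_set A I (carrier A) \<subseteq> I"

definition dedekind_brace :: "('a, 'm) ring_scheme \<Rightarrow> bool" where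
  "dedekind_brace A \<longleftrightarrow> left_brace A \<and> (\<forall>S. subbrace S A \<longrightarrow> brace_ideal S A)"

definition Soc :: "('a, 'm) ring_scheme \<Rightarrow> 'a set" where
  "Soc A = {a \<in> carrier A. \<forall>x \<in> carrier A. star A a x = \<zero>\<^bsub>A\<^esub>}"

text \<open>The quotient of a left brace by an ideal \<open>I\<close> is \<open>A Quot I\<close>: its elements are the
  additive cosets of \<open>I\<close>, which coincide with the multiplicative ones, and its operations are
  those induced on cosets. \<open>Soc2 A\<close> is the full preimage of the socle of \<open>A Quot Soc A\<close>.\<close>

definition Soc2 :: "('a, 'm) ring_scheme \<Rightarrow> 'a set" where
  "Soc2 A = {a \<in> carrier A. Soc A +>\<^bsub>A\<^esub> a \<in> Soc (A Quot Soc A)}"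

definition brace_centre :: "('a, 'm) ring_scheme \<Rightarrow> 'a set" where
  "brace_centre A = {a \<in> carrier A. \<forall>x \<in> carrier A.
     a \<otimes>\<^bsub>A\<^esub> x = a \<oplus>\<^bsub>A\<^esub> x \<and> a \<oplus>\<^bsub>A\<^esub> x = x \<otimes>\<^bsub>A\<^esub> a}"

definition brace_hom :: "('a, 'm) ring_scheme \<Rightarrow> ('b, 'n) ring_scheme \<Rightarrow> ('a \<Rightarrow> 'b) set" where
  "brace_hom A B = hom (add_monoid A) (add_monoid B) \<inter> hom A B"

definition brace_embedding :: "('a \<Rightarrow> 'b) \<Rightarrow> ('a, 'm) ring_scheme \<Rightarrow> ('b, 'n) ring_scheme \<Rightarrow> bool" where
  "brace_embedding f A B \<longleftrightarrow> f \<in> brace_hom A B \<and> inj_on f (carrier A)"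

definition periodic_group :: "('a, 'm) monoid_scheme \<Rightarrow> bool" where
  "periodic_group G \<longleftrightarrow> (\<forall>x \<in> carrier G. \<exists>n::nat. n > 0 \<and> x [^]\<^bsub>G\<^esub> n = \<one>\<^bsub>G\<^esub>)"

definition locally_cyclic_group :: "('a, 'm) monoid_scheme \<Rightarrow> bool" where
  "locally_cyclic_group G \<longleftrightarrow>
     (\<forall>F. finite F \<and> F \<subseteq> carrier G \<longrightarrow> cyclic_group (subgroup_generated G F))"

end

theory Submission
  imports Defs
begin

text \<open>
Write \<open>S\<close> for the socle and \<open>\<lambda>\<^sub>a(b) = ab - a = b + a \<ast> b\<close> for the action of \<open>A\<close> on its additive
group. The hypothesis \<open>A = Soc\<^sub>2(A)\<close> says \<open>A \<ast> A \<subseteq> S\<close>, and this makes \<open>\<lambda>\<close> a homomorphism on the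
additive group. Hence every additive subgroup closed under \<open>\<ast>\<close> is a subbrace, and so an ideal.
Two families of such subgroups carry the whole argument: all subgroups of \<open>S\<close>, and the subgroups
\<open>\<int>x + \<int>(x \<ast> x)\<close> (\<open>subbrace_cyclic_hull\<close>). The second family is used through its consequence
that \<open>x \<ast> a\<close> and \<open>a \<ast> x\<close> always lie in \<open>\<int>x + \<int>(x \<ast> x)\<close> (\<open>star_in_cyclic_hull\<close>).

If \<open>A\<close> is not periodic, then neither is \<open>S\<close> (\<open>Soc_not_torsion\<close>). As every cyclic subgroup of
\<open>S\<close> is an ideal, each \<open>\<lambda>\<^sub>b\<close> acts on \<open>S\<close> as \<open>1\<close> or as \<open>-1\<close> (\<open>lam_Soc_sign\<close>), and \<open>-1\<close> is impossible
(\<open>lam_Soc_not_inversion\<close>). So \<open>S\<close> is central and \<open>\<ast>\<close> is biadditive with values in \<open>S\<close>.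

Translating an argument by \<open>s \<in> S\<close> does not change a star product, so \<open>a \<ast> b\<close> lies in
\<open>\<int>(a + s) + \<int>(a \<ast> a)\<close> for every \<open>s \<in> S\<close>. Since \<open>S\<close> has elements of infinite order and
\<open>a \<ast> a\<close> has finite order, this forces \<open>a \<ast> b \<in> \<int>(a \<ast> a)\<close>, and likewise
\<open>a \<ast> b \<in> \<int>(b \<ast> b)\<close> (\<open>star_mem_multiples\<close>). A short computation then shows that the cyclic
groups \<open>\<int>(w \<ast> w)\<close> are directed (\<open>star_squares_directed\<close>). Their union is therefore \<open>A \<ast> A\<close>, which is
thus periodic and locally cyclic, and some nonzero multiple of each element of \<open>A\<close> lies in \<open>S\<close>.

Finally choose \<open>M\<close> maximal among the subgroups of \<open>S\<close> that meet \<open>A \<ast> A\<close> trivially, and put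
\<open>T = A/M\<close> and \<open>D = A/(A \<ast> A)\<close>. The diagonal map into \<open>T \<oplus> D\<close> is injective because
\<open>M \<inter> (A \<ast> A) = 0\<close>, and maximality of \<open>M\<close> makes \<open>T\<close> periodic
(\<open>exists_maximal_avoiding_torsion\<close>). The remaining properties of \<open>T\<close> are inherited from \<open>A\<close>.
\<close>

(* With this notation in force, integer multiples [k] \<cdot> x would be parsed ambiguously. *)
no_notation ideal_prod (infixl "\<cdot>\<index>" 80)

section \<open>Integer multiples in abelian groups\<close>

definition torsion :: "('a, 'm) ring_scheme \<Rightarrow> 'a \<Rightarrow> bool" where
  "torsion A x \<longleftrightarrow> (\<exists>k::int. k \<noteq> 0 \<and> [k] \<cdot>\<^bsub>A\<^esub> x = \<zero>\<^bsub>A\<^esub>)"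

definition multiples :: "('a, 'm) ring_scheme \<Rightarrow> 'a \<Rightarrow> 'a set" where
  "multiples A x = range (\<lambda>k::int. [k] \<cdot>\<^bsub>A\<^esub> x)"

context abelian_group
begin

lemma smult_closed: "x \<in> carrier G \<Longrightarrow> [(k::int)] \<cdot> x \<in> carrier G"
  by (rule add.int_pow_closed)

lemma smult_add: "\<lbrakk>x \<in> carrier G; y \<in> carrier G\<rbrakk> \<Longrightarrow> [(k::int)] \<cdot> (x \<oplus> y) = [k] \<cdot> x \<oplus> [k] \<cdot> y"
  by (rule add.int_pow_distrib)

lemma add_smult: "x \<in> carrier G \<Longrightarrow> [(k + l::int)] \<cdot> x = [k] \<cdot> x \<oplus> [l] \<cdot> x"
  by (rule add.int_pow_mult)

lemma smult_smult: "x \<in> carrier G \<Longrightarrow> [(k::int)] \<cdot> ([(l::int)] \<cdot> x) = [(k * l)] \<cdot> x"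
  by (simp add: add.int_pow_pow mult.commute)

lemma neg_smult: "x \<in> carrier G \<Longrightarrow> [(- k::int)] \<cdot> x = \<ominus> ([k] \<cdot> x)"
  by (rule add.int_pow_neg)

lemma smult_neg: "x \<in> carrier G \<Longrightarrow> [(k::int)] \<cdot> (\<ominus> x) = \<ominus> ([k] \<cdot> x)"
  by (rule add.int_pow_inv)

lemma diff_smult: "x \<in> carrier G \<Longrightarrow> [(k - l::int)] \<cdot> x = [k] \<cdot> x \<ominus> [l] \<cdot> x"
  using add_smult[of x k "- l"] by (simp add: neg_smult a_minus_def)

lemma smult_zero: "[(k::int)] \<cdot> \<zero> = \<zero>"
  by (rule add.int_pow_one)

lemma one_smult: "x \<in> carrier G \<Longrightarrow> [(1::int)] \<cdot> x = x"
  by (rule add.int_pow_1)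

lemma zero_smult: "[(0::int)] \<cdot> x = \<zero>"
  by (simp add: add_pow_def)

lemma minus_eq_zero_iff:
  "\<lbrakk>x \<in> carrier G; y \<in> carrier G\<rbrakk> \<Longrightarrow> x \<ominus> y = \<zero> \<longleftrightarrow> x = y"
  by (metis a_minus_def add.inv_closed minus_equality minus_minus r_neg)

lemma add_eq_add_imp_minus_eq:
  assumes "a \<in> carrier G" "b \<in> carrier G" "c \<in> carrier G" "d \<in> carrier G" "a \<oplus> b = c \<oplus> d"
  shows "a \<ominus> c = d \<ominus> b"
proof -
  have cancel: "(x \<oplus> z) \<ominus> (z \<oplus> y) = x \<ominus> y"
    if "x \<in> carrier G" "y \<in> carrier G" "z \<in> carrier G" for x y z
    using that by (simp add: a_minus_def minus_add a_assoc r_neg2)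
  have "a \<ominus> c = (a \<oplus> b) \<ominus> (b \<oplus> c)" using assms(1-3) by (simp add: cancel)
  also have "\<dots> = (d \<oplus> c) \<ominus> (c \<oplus> b)" unfolding assms(5) using assms(2-4) by (simp add: a_comm)
  also have "\<dots> = d \<ominus> b" using assms(2-4) by (simp add: cancel)
  finally show ?thesis .
qed

lemma smult_eq_iff:
  "x \<in> carrier G \<Longrightarrow> [(k::int)] \<cdot> x = [(l::int)] \<cdot> x \<longleftrightarrow> [(k - l)] \<cdot> x = \<zero>"
  by (simp add: diff_smult minus_eq_zero_iff smult_closed)

lemma not_torsion_smult_eq:
  assumes "x \<in> carrier G" "\<not> torsion G x" "[(k::int)] \<cdot> x = [(l::int)] \<cdot> x"
  shows "k = l"
proof -
  have "[(k - l)] \<cdot> x = \<zero>" using assms(1,3) smult_eq_iff by blast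
  then have "k - l = 0" using assms(2) unfolding torsion_def by blast
  then show ?thesis by simp
qed

lemma torsion_smult:
  assumes "x \<in> carrier G" "torsion G x"
  shows "torsion G ([(k::int)] \<cdot> x)"
proof -
  obtain n :: int where "n \<noteq> 0" "[n] \<cdot> x = \<zero>" using assms(2) torsion_def by metis
  then have "[n] \<cdot> ([k] \<cdot> x) = \<zero>"
    using assms(1) by (metis mult.commute smult_smult smult_zero)
  with \<open>n \<noteq> 0\<close> show ?thesis unfolding torsion_def by blast
qed

lemma torsion_add:
  assumes "x \<in> carrier G" "y \<in> carrier G" "torsion G x" "torsion G y"
  shows "torsion G (x \<oplus> y)"
proof -
  obtain n m :: int where n: "n \<noteq> 0" "[n] \<cdot> x = \<zero>" and m: "m \<noteq> 0" "[m] \<cdot> y = \<zero>"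
    using assms(3,4) torsion_def by metis
  have "[(m * n)] \<cdot> (x \<oplus> y) = [m] \<cdot> ([n] \<cdot> x) \<oplus> [n] \<cdot> ([m] \<cdot> y)"
    using assms(1,2) by (simp add: smult_add smult_smult mult.commute)
  also have "\<dots> = \<zero>" using n m by (simp add: smult_zero)
  finally show ?thesis unfolding torsion_def using n(1) m(1) by (metis mult_eq_0_iff)
qed

lemma torsion_of_smult:
  assumes "x \<in> carrier G" "torsion G ([(k::int)] \<cdot> x)" "k \<noteq> 0"
  shows "torsion G x"
proof -
  obtain n :: int where "n \<noteq> 0" "[n] \<cdot> ([k] \<cdot> x) = \<zero>" using assms(2) torsion_def by metis
  then show ?thesis unfolding torsion_def using assms(1,3) smult_smult[of x n k]
    by (intro exI[of _ "n * k"]) simp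
qed

lemma periodic_iff_torsion:
  "periodic_group (add_monoid G) \<longleftrightarrow> (\<forall>x \<in> carrier G. torsion G x)"
proof -
  have "(\<exists>n::nat. n > 0 \<and> [n] \<cdot> x = \<zero>) \<longleftrightarrow> torsion G x" if x: "x \<in> carrier G" for x
  proof
    assume "\<exists>n::nat. n > 0 \<and> [n] \<cdot> x = \<zero>"
    then obtain n :: nat where "n > 0" "[n] \<cdot> x = \<zero>" by blast
    then have "int n \<noteq> 0" "[(int n)] \<cdot> x = \<zero>" by (simp_all add: add_pow_def int_pow_int)
    then show "torsion G x" unfolding torsion_def by blast
  next
    assume "torsion G x"
    then obtain k :: int where k: "k \<noteq> 0" "[k] \<cdot> x = \<zero>" unfolding torsion_def by blast
    have "[\<bar>k\<bar>] \<cdot> x = \<zero>" using k(2) x by (simp add: abs_if neg_smult)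
    then have "[(int (nat \<bar>k\<bar>))] \<cdot> x = \<zero>" by simp
    then have "[(nat \<bar>k\<bar>)] \<cdot> x = \<zero>" unfolding add_pow_def int_pow_int .
    then show "\<exists>n::nat. n > 0 \<and> [n] \<cdot> x = \<zero>" using k(1) by (intro exI[of _ "nat \<bar>k\<bar>"]) simp
  qed
  then show ?thesis unfolding periodic_group_def by (simp add: add_pow_def)
qed

lemma multiplesI: "[(k::int)] \<cdot> x \<in> multiples G x"
  unfolding multiples_def by blast

lemma multiplesE:
  assumes "y \<in> multiples G x"
  obtains k :: int where "y = [k] \<cdot> x"
  using assms unfolding multiples_def by blast

lemma subgroup_multiples:
  assumes "x \<in> carrier G"
  shows "subgroup (multiples G x) (add_monoid G)"
proof (rule add.subgroupI)
  show "multiples G x \<subseteq> carrier G" unfolding multiples_def using assms by (auto simp: smult_closed)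
  show "multiples G x \<noteq> {}" unfolding multiples_def by blast
  show "\<ominus> a \<in> multiples G x" if "a \<in> multiples G x" for a
    using that assms unfolding multiples_def by (auto simp: neg_smult[symmetric])
  show "a \<oplus> b \<in> multiples G x" if "a \<in> multiples G x" "b \<in> multiples G x" for a b
    using that assms unfolding multiples_def by (auto simp: add_smult[symmetric])
qed

lemma subgroup_smult:
  assumes "subgroup H (add_monoid G)" "x \<in> H"
  shows "[(k::int)] \<cdot> x \<in> H"
  using group.subgroup_int_pow_closed[OF a_group assms] by (simp add: add_pow_def)

lemma multiples_subset:
  assumes "subgroup H (add_monoid G)" "x \<in> H"
  shows "multiples G x \<subseteq> H"
  using subgroup_smult[OF assms] unfolding multiples_def by blast

lemma subgroup_minus:
  assumes "subgroup H (add_monoid G)" "x \<in> H" "y \<in> H"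
  shows "x \<ominus> y \<in> H"
  using subgroup.m_closed[OF assms(1,2) subgroup.m_inv_closed[OF assms(1,3)]]
  by (simp add: a_minus_def a_inv_def)

text \<open>
  The coefficient \<open>u\<close> must vanish for a suitable \<open>s\<close>. If \<open>c\<close> is torsion, choose \<open>s\<close>
  such that \<open>x \<oplus> s\<close> is not torsion. If \<open>c\<close> were not torsion, then modulo torsion \<open>x\<close> would be a
  rational multiple of \<open>c\<close>, and comparing the choices \<open>s = \<zero>\<close> and \<open>s = 3c\<close> yields
  \<open>k = u (1 + 3k)\<close> with \<open>k \<noteq> 0\<close>, which has no integer solution.
\<close>
lemma mem_multiples_of_translates:
  assumes S: "subgroup S (add_monoid G)" and s0: "s0 \<in> S" "\<not> torsion G s0"
    and x: "x \<in> carrier G" and c: "c \<in> S" and t: "t \<in> carrier G" "torsion G t"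
    and translates: "\<And>s. s \<in> S \<Longrightarrow> \<exists>(u::int) (v::int). c = [u] \<cdot> (x \<oplus> s) \<oplus> [v] \<cdot> t"
  shows "c \<in> multiples G t"
proof -
  have SG: "s \<in> carrier G" if "s \<in> S" for s using subgroup.mem_carrier[OF S that] by simp
  have zero_S: "\<zero> \<in> S" using subgroup.one_closed[OF S] by simp
  have cG: "c \<in> carrier G" using SG c .
  have tor_c: "torsion G c"
  proof (rule ccontr)
    assume nt: "\<not> torsion G c"
    obtain n :: int where n: "n \<noteq> 0" "[n] \<cdot> t = \<zero>" using t(2) torsion_def by metis
    have kill: "[n] \<cdot> ([v] \<cdot> t) = \<zero>" for v :: int
      using smult_smult[OF t(1), of v n] n(2) t(1)
      by (simp add: smult_smult mult.commute smult_zero)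
    obtain k v where k: "c = [(k::int)] \<cdot> (x \<oplus> \<zero>) \<oplus> [(v::int)] \<cdot> t"
      using translates[OF zero_S] by (elim exE) (rule that)
    have nc: "[n] \<cdot> c = [(n * k)] \<cdot> x"
      using arg_cong[OF k, of "\<lambda>z. [n] \<cdot> z"] x t(1)
      by (simp add: smult_add smult_closed kill smult_smult)
    have k0: "k \<noteq> 0"
      using nc nt n(1) unfolding torsion_def by (auto simp: zero_smult)
    obtain u v' where u: "c = [(u::int)] \<cdot> (x \<oplus> [(3::int)] \<cdot> c) \<oplus> [(v'::int)] \<cdot> t"
      using translates[OF subgroup_smult[OF S c, of 3]] by (elim exE) (rule that)
    have nc': "[n] \<cdot> c = [(n * u)] \<cdot> x \<oplus> [(n * u * 3)] \<cdot> c"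
      using arg_cong[OF u, of "\<lambda>z. [n] \<cdot> z"] x t(1) cG
      by (simp add: smult_add smult_closed kill smult_smult mult.assoc)
    have "[(k * n)] \<cdot> c = [k] \<cdot> ([(n * u)] \<cdot> x \<oplus> [(n * u * 3)] \<cdot> c)"
      using smult_smult[OF cG, of k n, symmetric] arg_cong[OF nc', of "\<lambda>z. [k] \<cdot> z"] by (rule trans)
    also have "\<dots> = [u] \<cdot> ([(n * k)] \<cdot> x) \<oplus> [(k * (n * u * 3))] \<cdot> c"
      using x cG by (simp add: smult_add smult_closed smult_smult ac_simps)
    also have "\<dots> = [(u * n + k * (n * u * 3))] \<cdot> c"
      using cG nc[symmetric] by (simp add: add_smult smult_smult)
    finally have "k * n = u * n + k * (n * u * 3)"
      by (rule not_torsion_smult_eq[OF cG nt])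
    then have "n * k = n * (u * (1 + 3 * k))" by (simp add: algebra_simps)
    then have eq: "k = u * (1 + 3 * k)" unfolding mult_cancel_left using n(1) by blast
    have "1 + 3 * k dvd k" by (rule dvdI[OF eq[unfolded mult.commute[of u]]])
    then have "1 + 3 * k dvd (1 + 3 * k) - 3 * k"
      by (intro dvd_diff dvd_mult dvd_refl)
    then have "\<bar>1 + 3 * k\<bar> = 1" by simp
    with k0 show False by arith
  qed
  obtain s where s: "s \<in> S" "\<not> torsion G (x \<oplus> s)"
  proof (cases "torsion G x")
    case False
    then show ?thesis using that[OF zero_S] x by simp
  next
    case True
    have "\<not> torsion G (x \<oplus> s0)"
    proof
      assume "torsion G (x \<oplus> s0)"
      then have "torsion G ((x \<oplus> s0) \<oplus> [(-1::int)] \<cdot> x)"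
        using True x SG[OF s0(1)] by (intro torsion_add[of "x \<oplus> s0"] torsion_smult) (auto simp: smult_closed)
      moreover have "(x \<oplus> s0) \<oplus> [(-1::int)] \<cdot> x = s0"
        using x SG[OF s0(1)] by (simp add: neg_smult one_smult a_ac r_neg)
      ultimately show False using s0(2) by simp
    qed
    then show ?thesis using that s0(1) by blast
  qed
  obtain u v where uv: "c = [(u::int)] \<cdot> (x \<oplus> s) \<oplus> [(v::int)] \<cdot> t" 
    using translates[OF s(1)] by (elim exE) (rule that)
  have xs: "x \<oplus> s \<in> carrier G" using x SG[OF s(1)] by simp
  have "[u] \<cdot> (x \<oplus> s) = c \<oplus> [(- v)] \<cdot> t"
    using uv xs t(1) by (simp add: neg_smult smult_closed a_assoc r_neg)
  then have "torsion G ([u] \<cdot> (x \<oplus> s))"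
    using tor_c cG t by (simp add: torsion_add torsion_smult smult_closed)
  then have "u = 0" using torsion_of_smult[OF xs] s(2) by blast
  then have "c = [v] \<cdot> t" using uv t(1) by (simp add: zero_smult smult_closed)
  then show ?thesis using multiplesI by simp
qed

text \<open>
  The exponents that carry \<open>g\<close> into \<open>H\<close> form a subgroup of the integers, and their least
  positive member, if there is one, generates them.
\<close>
lemma subgroup_of_multiples:
  assumes H: "subgroup H (add_monoid G)" and g: "g \<in> carrier G" and sub: "H \<subseteq> multiples G g"
  shows "\<exists>h \<in> H. H = multiples G h"
proof (cases "\<exists>n::nat. n > 0 \<and> [(int n)] \<cdot> g \<in> H")
  case False
  have zero_H: "\<zero> \<in> H" using subgroup.one_closed[OF H] by simp
  have "H \<subseteq> {\<zero>}"
  proof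
    fix y assume y: "y \<in> H"
    then obtain k :: int where k: "y = [k] \<cdot> g" using sub by (blast elim: multiplesE)
    have "[(- k)] \<cdot> g \<in> H" using subgroup_smult[OF H y, of "-1"] g k by (simp add: smult_smult)
    moreover have "\<not> [j] \<cdot> g \<in> H" if "j > 0" for j :: int
      using False that zero_less_imp_eq_int[OF that] by blast
    ultimately have "\<not> k > 0" "\<not> - k > 0" using y k by blast+
    then have "k = 0" by simp
    then show "y \<in> {\<zero>}" using k by (simp add: zero_smult)
  qed
  then have "H = multiples G \<zero>" using zero_H by (auto simp: multiples_def smult_zero)
  then show ?thesis using zero_H by blast
next
  case True
  define d where "d = (LEAST n::nat. n > 0 \<and> [(int n)] \<cdot> g \<in> H)"
  have d: "d > 0" "[(int d)] \<cdot> g \<in> H" using LeastI_ex[OF True] unfolding d_def by auto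
  have least: "\<not> (n > 0 \<and> [(int n)] \<cdot> g \<in> H)" if "n < d" for n
    using not_less_Least that unfolding d_def by blast
  have "H \<subseteq> multiples G ([(int d)] \<cdot> g)"
  proof
    fix y assume y: "y \<in> H"
    then obtain k :: int where k: "y = [k] \<cdot> g" using sub by (blast elim: multiplesE)
    have "y \<ominus> [(k div int d)] \<cdot> ([(int d)] \<cdot> g) \<in> H"
      by (intro subgroup_minus[OF H] y subgroup_smult[OF H] d(2))
    also have "y \<ominus> [(k div int d)] \<cdot> ([(int d)] \<cdot> g) = [(k mod int d)] \<cdot> g"
      using g k by (simp add: smult_smult diff_smult[symmetric] minus_div_mult_eq_mod)
    finally have "[(int (nat (k mod int d)))] \<cdot> g \<in> H" using d(1) by simp
    moreover have "nat (k mod int d) < d"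
      using d(1) by (simp add: nat_less_iff)
    ultimately have "\<not> nat (k mod int d) > 0" 
      using least[of "nat (k mod int d)"] by simp
    then have "k mod int d = 0" using d(1) by (intro order_antisym) simp_all
    then have "y = [(k div int d)] \<cdot> ([(int d)] \<cdot> g)"
      using k smult_smult[OF g, of "k div int d" "int d"] div_mult_mod_eq[of k "int d"] by simp
    then show "y \<in> multiples G ([(int d)] \<cdot> g)" using multiplesI by simp
  qed
  moreover have "multiples G ([(int d)] \<cdot> g) \<subseteq> H" by (rule multiples_subset[OF H d(2)])
  ultimately show ?thesis using d(2) by blast
qed

text \<open>
A group is locally cyclic as soon as every finite subset lies in some cyclic subgroup, because
subgroups of cyclic groups are cyclic.
\<close>
lemma locally_cyclic_subgroupI:
  assumes K: "subgroup K (add_monoid G)"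
    and cyc: "\<And>F. \<lbrakk>finite F; F \<subseteq> K\<rbrakk> \<Longrightarrow> \<exists>g \<in> K. F \<subseteq> multiples G g"
  shows "locally_cyclic_group ((add_monoid G)\<lparr>carrier := K\<rparr>)"
  unfolding locally_cyclic_group_def
proof (intro allI impI)
  let ?K = "(add_monoid G)\<lparr>carrier := K\<rparr>"
  fix F assume "finite F \<and> F \<subseteq> carrier ?K"
  then have F: "finite F" "F \<subseteq> K" by auto
  then obtain g where g: "g \<in> K" "F \<subseteq> multiples G g" using cyc by blast
  have KG: "K \<subseteq> carrier G" using subgroup.subset[OF K] by simp
  define H where "H = generate (add_monoid G) F"
  have H: "subgroup H (add_monoid G)"
    unfolding H_def using F(2) KG by (intro add.generate_is_subgroup) auto
  have "H \<subseteq> multiples G g"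
    unfolding H_def using g KG by (intro add.generate_subgroup_incl subgroup_multiples) auto
  then obtain h where h: "h \<in> H" "H = multiples G h" using subgroup_of_multiples[OF H] g KG by blast
  have eq: "subgroup_generated ?K F = (add_monoid G)\<lparr>carrier := H\<rparr>"
    using F(2) unfolding subgroup_generated_def H_def
    by (simp add: inf.absorb2 add.generate_consistent[OF _ K, simplified] group.generate_consistent[OF a_group F(2) K])
  have grp: "group ((add_monoid G)\<lparr>carrier := H\<rparr>)"
    using group.subgroup_imp_group[OF a_group H] .
  have pow: "h [^]\<^bsub>(add_monoid G)\<lparr>carrier := H\<rparr>\<^esub> (k::int) = [k] \<cdot> h" for k
    using group.int_pow_consistent[OF a_group H h(1), of k] unfolding add_pow_def by simp
  have pow_fun: "(\<lambda>k::int. h [^]\<^bsub>(add_monoid G)\<lparr>carrier := H\<rparr>\<^esub> k) = (\<lambda>k. [k] \<cdot> h)"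
    using pow by (rule ext)
  have "carrier ((add_monoid G)\<lparr>carrier := H\<rparr>)
      = range (\<lambda>k::int. h [^]\<^bsub>(add_monoid G)\<lparr>carrier := H\<rparr>\<^esub> k)"
    unfolding pow_fun using h(2) by (simp add: multiples_def)
  moreover have "h \<in> carrier ((add_monoid G)\<lparr>carrier := H\<rparr>)" using h(1) by simp
  ultimately show "cyclic_group (subgroup_generated ?K F)"
    unfolding eq group.cyclic_group[OF grp] by blast
qed

end

lemma (in abelian_group) finite_multiples:
  assumes x: "x \<in> carrier G" and tor: "torsion G x"
  shows "finite (multiples G x)"
proof -
  obtain n :: int where n: "n \<noteq> 0" "[n] \<cdot> x = \<zero>" using tor unfolding torsion_def by blast
  have "multiples G x \<subseteq> (\<lambda>k. [k] \<cdot> x) ` {- \<bar>n\<bar>..\<bar>n\<bar>}"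
  proof
    fix y assume "y \<in> multiples G x"
    then obtain k :: int where k: "y = [k] \<cdot> x" by (rule multiplesE)
    have "[k] \<cdot> x = [(k div n)] \<cdot> ([n] \<cdot> x) \<oplus> [(k mod n)] \<cdot> x"
      by (simp add: smult_smult[OF x] add_smult[OF x, symmetric])
    also have "\<dots> = [(k mod n)] \<cdot> x" using n(2) x by (simp add: smult_zero smult_closed)
    finally have "y = [(k mod n)] \<cdot> x" using k by simp
    moreover have "k mod n \<in> {- \<bar>n\<bar>..\<bar>n\<bar>}" using abs_mod_less[OF n(1), of k] by auto
    ultimately show "y \<in> (\<lambda>k. [k] \<cdot> x) ` {- \<bar>n\<bar>..\<bar>n\<bar>}" by blast
  qed
  then show ?thesis by (rule finite_surj[rotated]) simp
qed

text \<open>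
Take \<open>M\<close> maximal by Zorn's lemma. If \<open>s \<in> S\<close> is not in \<open>M\<close>, then \<open>M + \<int>s\<close> meets \<open>K\<close> in some
\<open>m + ks \<noteq> 0\<close>, where \<open>k \<noteq> 0\<close> since \<open>M\<close> avoids \<open>K\<close>. An exponent \<open>n\<close> killing this element gives
\<open>(nk)s = -nm \<in> M\<close>. So \<open>S\<close> is periodic modulo \<open>M\<close>.
\<close>
lemma (in abelian_group) exists_maximal_avoiding_torsion:
  assumes S: "subgroup S (add_monoid G)" and K: "subgroup K (add_monoid G)"
    and tor: "\<And>x. x \<in> K \<Longrightarrow> torsion G x"
  obtains M where "subgroup M (add_monoid G)" "M \<subseteq> S" "M \<inter> K = {\<zero>}"
    "\<And>s. s \<in> S \<Longrightarrow> \<exists>n::int. n \<noteq> 0 \<and> [n] \<cdot> s \<in> M"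
proof -
  define P where "P = {M. subgroup M (add_monoid G) \<and> M \<subseteq> S \<and> M \<inter> K = {\<zero>}}"
  have "{\<zero>} \<in> P"
    unfolding P_def using subgroup.one_closed[OF S] subgroup.one_closed[OF K] add.triv_subgroup by auto
  moreover have "\<Union>C \<in> P" if C: "C \<noteq> {}" "subset.chain P C" for C
  proof -
    have CP: "C \<subseteq> P" and chain: "\<And>X Y. \<lbrakk>X \<in> C; Y \<in> C\<rbrakk> \<Longrightarrow> X \<subseteq> Y \<or> Y \<subseteq> X"
      using C(2) unfolding subset_chain_def by blast+
    have sub: "subgroup X (add_monoid G)" if "X \<in> C" for X using that CP unfolding P_def by blast
    obtain X0 where X0: "X0 \<in> C" using C(1) by blast
    have "subgroup (\<Union>C) (add_monoid G)"
    proof (rule add.subgroupI)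
      show "\<Union>C \<subseteq> carrier G" using subgroup.subset[OF sub] by auto
      show "\<Union>C \<noteq> {}" using X0 subgroup.one_closed[OF sub[OF X0]] by blast
      show "\<ominus> x \<in> \<Union>C" if "x \<in> \<Union>C" for x
        using that subgroup.m_inv_closed[OF sub, folded a_inv_def] by auto
      show "x \<oplus> y \<in> \<Union>C" if xy: "x \<in> \<Union>C" "y \<in> \<Union>C" for x y
      proof -
        obtain X where X: "X \<in> C" "x \<in> X" using xy(1) by (rule UnionE)
        obtain Y where Y: "Y \<in> C" "y \<in> Y" using xy(2) by (rule UnionE)
        obtain Z where "Z \<in> C" "x \<in> Z" "y \<in> Z" using chain[OF X(1) Y(1)] X Y by blast
        then show ?thesis using subgroup.m_closed[OF sub] by auto
      qed
    qed
    moreover have "\<Union>C \<subseteq> S" using CP unfolding P_def by blast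
    moreover have "\<Union>C \<inter> K = {\<zero>}" using CP X0 unfolding P_def by blast
    ultimately show ?thesis unfolding P_def by blast
  qed
  ultimately have "\<exists>M \<in> P. \<forall>X \<in> P. M \<subseteq> X \<longrightarrow> X = M"
    by (intro subset_Zorn_nonempty) auto
  then obtain M where MP: "M \<in> P" and max: "\<And>X. \<lbrakk>X \<in> P; M \<subseteq> X\<rbrakk> \<Longrightarrow> X = M" by blast
  have M: "subgroup M (add_monoid G)" "M \<subseteq> S" "M \<inter> K = {\<zero>}" using MP unfolding P_def by blast+
  have SG: "x \<in> carrier G" if "x \<in> S" for x using subgroup.mem_carrier[OF S that] by simp
  have MG: "x \<in> carrier G" if "x \<in> M" for x using SG M(2) that by blast
  have zero_M: "\<zero> \<in> M" using subgroup.one_closed[OF M(1)] by simp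
  have "\<exists>n::int. n \<noteq> 0 \<and> [n] \<cdot> s \<in> M" if s: "s \<in> S" for s
  proof -
    have sG: "s \<in> carrier G" by (rule SG[OF s])
    define N where "N = {m \<oplus> [k] \<cdot> s | m (k::int). m \<in> M}"
    have N: "subgroup N (add_monoid G)"
    proof (rule add.subgroupI)
      show "N \<subseteq> carrier G" unfolding N_def using MG sG by (auto simp: smult_closed)
      show "N \<noteq> {}" unfolding N_def using zero_M by blast
      show "\<ominus> x \<in> N" if x: "x \<in> N" for x
      proof -
        obtain m and k :: int where "x = m \<oplus> [k] \<cdot> s" "m \<in> M" using x unfolding N_def by blast
        moreover from this have "\<ominus> x = \<ominus> m \<oplus> [(- k)] \<cdot> s"
          using MG sG by (simp add: minus_add neg_smult smult_closed)
        moreover have "\<ominus> m \<in> M" using subgroup.m_inv_closed[OF M(1), folded a_inv_def] \<open>m \<in> M\<close> .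
        ultimately show ?thesis unfolding N_def by blast
      qed
      show "x \<oplus> y \<in> N" if xy: "x \<in> N" "y \<in> N" for x y
      proof -
        obtain m and k :: int where x: "x = m \<oplus> [k] \<cdot> s" "m \<in> M" using xy(1) unfolding N_def by blast
        obtain m' and k' :: int where y: "y = m' \<oplus> [k'] \<cdot> s" "m' \<in> M" using xy(2) unfolding N_def by blast
        have "x \<oplus> y = (m \<oplus> m') \<oplus> [(k + k')] \<cdot> s"
          using x y MG sG by (simp add: add_smult smult_closed a_ac)
        moreover have "m \<oplus> m' \<in> M" using subgroup.m_closed[OF M(1) x(2) y(2)] by simp
        ultimately show ?thesis unfolding N_def by blast
      qed
    qed
    have MN: "M \<subseteq> N"
    proof
      fix m assume m: "m \<in> M"
      then have "m = m \<oplus> [(0::int)] \<cdot> s" using MG by (simp add: zero_smult)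
      then show "m \<in> N" unfolding N_def using m by blast
    qed
    have sN: "s \<in> N"
    proof -
      have "s = \<zero> \<oplus> [(1::int)] \<cdot> s" using sG by simp
      then show ?thesis unfolding N_def using zero_M by blast
    qed
    have NS: "N \<subseteq> S"
    proof
      fix x assume "x \<in> N"
      then obtain m and k :: int where "x = m \<oplus> [k] \<cdot> s" "m \<in> M" unfolding N_def by blast
      then show "x \<in> S"
        using subgroup.m_closed[OF S, of m "[k] \<cdot> s"] subgroup_smult[OF S s, of k] M(2) by auto
    qed
    show ?thesis
    proof (cases "N \<inter> K = {\<zero>}")
      case True
      then have "N = M" using N NS MN by (intro max) (simp_all add: P_def)
      then have "[(1::int)] \<cdot> s \<in> M" using sN sG by simp
      then show ?thesis by (intro exI[of _ "1::int"]) simp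
    next
      case False
      then obtain x where x: "x \<in> N" "x \<in> K" "x \<noteq> \<zero>" using zero_M MN M(3) by blast
      obtain m and k :: int where mk: "x = m \<oplus> [k] \<cdot> s" "m \<in> M" using x(1) unfolding N_def by blast
      have k0: "k \<noteq> 0"
      proof
        assume "k = 0"
        then have "x = m" using mk MG by (simp add: zero_smult)
        then show False using mk(2) x(2,3) M(3) by blast
      qed
      obtain n :: int where n: "n \<noteq> 0" "[n] \<cdot> x = \<zero>"
        using tor[OF x(2)] unfolding torsion_def by (elim exE conjE)
      have "[n] \<cdot> m \<oplus> [(n * k)] \<cdot> s = \<zero>"
        using n(2) mk MG sG by (simp add: smult_add smult_smult smult_closed)
      then have "[(n * k)] \<cdot> s = \<ominus> ([n] \<cdot> m)"
        using MG[OF mk(2)] sG by (metis a_comm minus_equality smult_closed)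
      also have "\<dots> = [(- n)] \<cdot> m" using MG[OF mk(2)] by (simp add: neg_smult)
      finally have "[(n * k)] \<cdot> s \<in> M" using subgroup_smult[OF M(1) mk(2)] by simp
      then show ?thesis using n(1) k0 by (intro exI[of _ "n * k"]) simp
    qed
  qed
  with M show ?thesis by (rule that)
qed

section \<open>Left braces and their socle\<close>

text \<open>
The translation-corrected left multiplication \<open>\<lambda>\<^sub>a\<close>. It turns the brace axiom into
additivity, and the multiplicative group acts through it by additive automorphisms.
\<close>
definition lam :: "('a, 'm) ring_scheme \<Rightarrow> 'a \<Rightarrow> 'a \<Rightarrow> 'a" where
  "lam A a b = (a \<otimes>\<^bsub>A\<^esub> b) \<ominus>\<^bsub>A\<^esub> a"

context left_brace
begin

lemma lam_closed: "\<lbrakk>a \<in> carrier A; b \<in> carrier A\<rbrakk> \<Longrightarrow> lam A a b \<in> carrier A"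
  unfolding lam_def by simp

lemma mult_eq_add_lam:
  "\<lbrakk>a \<in> carrier A; b \<in> carrier A\<rbrakk> \<Longrightarrow> a \<otimes> b = a \<oplus> lam A a b"
  unfolding lam_def a_minus_def by (metis a_comm a_lcomm add.inv_closed m_closed r_neg r_zero)

lemma star_eq: "\<lbrakk>a \<in> carrier A; b \<in> carrier A\<rbrakk> \<Longrightarrow> star A a b = lam A a b \<ominus> b"
  unfolding star_def lam_def ..

lemma star_closed: "\<lbrakk>a \<in> carrier A; b \<in> carrier A\<rbrakk> \<Longrightarrow> star A a b \<in> carrier A"
  by (simp add: star_eq lam_closed)

lemma add_minus_cancel: "\<lbrakk>a \<in> carrier A; b \<in> carrier A\<rbrakk> \<Longrightarrow> b \<oplus> (a \<ominus> b) = a"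
  unfolding a_minus_def by (metis a_comm a_lcomm add.inv_closed r_neg r_zero)

lemma lam_eq_add_star: "\<lbrakk>a \<in> carrier A; b \<in> carrier A\<rbrakk> \<Longrightarrow> lam A a b = b \<oplus> star A a b"
  by (simp add: star_eq add_minus_cancel lam_closed)

lemma lam_add:
  assumes "a \<in> carrier A" "b \<in> carrier A" "c \<in> carrier A"
  shows "lam A a (b \<oplus> c) = lam A a b \<oplus> lam A a c"
proof -
  have "lam A a (b \<oplus> c) = ((a \<otimes> b) \<oplus> (a \<otimes> c)) \<oplus> \<ominus> a \<oplus> \<ominus> a"
    unfolding lam_def using assms by (simp add: brace_distr a_minus_def)
  also have "\<dots> = lam A a b \<oplus> lam A a c"
    unfolding lam_def using assms by (simp add: a_minus_def a_ac)
  finally show ?thesis .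
qed

lemma lam_hom: "a \<in> carrier A \<Longrightarrow> lam A a \<in> hom (add_monoid A) (add_monoid A)"
  by (simp add: hom_def lam_closed lam_add)

lemma lam_smult:
  "\<lbrakk>a \<in> carrier A; b \<in> carrier A\<rbrakk> \<Longrightarrow> lam A a ([(k::int)] \<cdot> b) = [k] \<cdot> lam A a b"
  using hom_int_pow[OF lam_hom _ a_group a_group, of a b k] by (simp add: add_pow_def)

lemma lam_lam:
  assumes "a \<in> carrier A" "b \<in> carrier A" "c \<in> carrier A"
  shows "lam A (a \<otimes> b) c = lam A a (lam A b c)"
proof -
  have "a \<otimes> b \<oplus> lam A (a \<otimes> b) c = a \<otimes> (b \<oplus> lam A b c)"
    using assms by (simp add: mult_eq_add_lam[symmetric] m_assoc)
  also have "\<dots> = a \<oplus> lam A a (b \<oplus> lam A b c)"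
    using assms by (simp add: mult_eq_add_lam[of a "b \<oplus> _"] lam_closed)
  also have "\<dots> = a \<otimes> b \<oplus> lam A a (lam A b c)"
    using assms by (simp add: lam_add lam_closed mult_eq_add_lam a_assoc)
  finally show ?thesis using assms by (simp add: lam_closed)
qed

lemma lam_one: "b \<in> carrier A \<Longrightarrow> lam A \<zero> b = b"
  using mult_eq_add_lam[of \<zero> b] l_one[of b, folded zero_eq_one] by (simp add: lam_closed)

lemma lam_inv_cancel:
  assumes "a \<in> carrier A" "b \<in> carrier A"
  shows "lam A (inv a) (lam A a b) = b" "lam A a (lam A (inv a) b) = b"
  using assms lam_lam[of "inv a" a b] lam_lam[of a "inv a" b] lam_one[of b]
  by (simp_all flip: zero_eq_one)

lemma Soc_iff_lam:
  "a \<in> Soc A \<longleftrightarrow> a \<in> carrier A \<and> (\<forall>x \<in> carrier A. lam A a x = x)"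
  unfolding Soc_def by (auto simp: star_eq lam_closed minus_eq_zero_iff)

lemma Soc_closed: "a \<in> Soc A \<Longrightarrow> a \<in> carrier A"
  by (simp add: Soc_def)

lemma Soc_mult: "\<lbrakk>a \<in> Soc A; x \<in> carrier A\<rbrakk> \<Longrightarrow> a \<otimes> x = a \<oplus> x"
  using Soc_iff_lam mult_eq_add_lam by metis

lemma Soc_mult_closed: "\<lbrakk>a \<in> Soc A; b \<in> Soc A\<rbrakk> \<Longrightarrow> a \<otimes> b \<in> Soc A"
  by (simp add: Soc_iff_lam lam_lam)

lemma Soc_inv_closed: 
  assumes "a \<in> Soc A" shows "inv a \<in> Soc A"
proof -
  have "lam A (inv a) x = x" if "x \<in> carrier A" for x
    using lam_inv_cancel(1)[of a x] assms that Soc_iff_lam by simp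
  then show ?thesis using assms by (simp add: Soc_iff_lam)
qed

lemma Soc_inv_eq:
  assumes "a \<in> Soc A" shows "inv a = \<ominus> a"
proof -
  have "a \<oplus> inv a = \<zero>"
    using assms Soc_mult[of a "inv a"] Soc_closed zero_eq_one by (metis inv_closed r_inv)
  then show ?thesis using assms Soc_closed by (metis a_comm inv_closed minus_equality)
qed

lemma subgroup_Soc: "subgroup (Soc A) (add_monoid A)"
proof (rule add.subgroupI)
  show "Soc A \<subseteq> carrier A" using Soc_closed by blast
  show "Soc A \<noteq> {}" using lam_one Soc_iff_lam by blast
  show "\<ominus> a \<in> Soc A" if "a \<in> Soc A" for a
    using Soc_inv_closed[OF that] Soc_inv_eq[OF that] by simp
  show "a \<oplus> b \<in> Soc A" if "a \<in> Soc A" "b \<in> Soc A" for a b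
    using Soc_mult_closed[OF that] Soc_mult[OF that(1) Soc_closed[OF that(2)]] by simp
qed

text \<open>
On the socle the two operations agree, so additive subgroups need no further closure.
\<close>
lemma subbrace_of_Soc:
  assumes X: "subgroup X (add_monoid A)" and sub: "X \<subseteq> Soc A"
  shows "subbrace X A"
  unfolding subbrace_def
proof
  show "subgroup X A"
  proof (rule subgroupI)
    show "X \<subseteq> carrier A" using sub Soc_closed by blast
    show "X \<noteq> {}" using subgroup.one_closed[OF X] by blast
    show "inv a \<in> X" if "a \<in> X" for a
      using subgroup.m_inv_closed[OF X that] Soc_inv_eq[of a] that sub by (auto simp: a_inv_def)
    show "a \<otimes> b \<in> X" if "a \<in> X" "b \<in> X" for a b
    proof -
      have "a \<oplus> b \<in> X" using subgroup.m_closed[OF X that] by simp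
      then show ?thesis using that sub Soc_mult[of a b] Soc_closed by (simp add: subset_iff)
    qed
  qed
qed (rule X)

lemma lam_Soc_add:
  assumes "s \<in> Soc A" "a \<in> carrier A" "x \<in> carrier A"
  shows "lam A (s \<oplus> a) x = lam A a x"
proof -
  have "lam A (s \<oplus> a) x = lam A s (lam A a x)"
    using assms Soc_mult[of s a] by (simp flip: lam_lam add: Soc_closed)
  then show ?thesis using assms by (simp add: Soc_iff_lam lam_closed)
qed

lemma star_setI:
  "\<lbrakk>x \<in> X; y \<in> Y\<rbrakk> \<Longrightarrow> star A x y \<in> star_set A X Y"
  unfolding star_set_def by (intro generate.incl) blast

lemma brace_ideal_star:
  assumes "brace_ideal I A" "i \<in> I" "a \<in> carrier A"
  shows "star A a i \<in> I" "star A i a \<in> I"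
  using assms star_setI unfolding brace_ideal_def by blast+

lemma star_set_minimal:
  assumes I: "subgroup I (add_monoid A)" and "\<And>x y. \<lbrakk>x \<in> X; y \<in> Y\<rbrakk> \<Longrightarrow> star A x y \<in> I"
  shows "star_set A X Y \<subseteq> I"
  unfolding star_set_def
  by (rule group.generate_subgroup_incl[OF a_group _ I]) (use assms(2) in blast)

lemma subgroup_star_set:
  "\<lbrakk>X \<subseteq> carrier A; Y \<subseteq> carrier A\<rbrakk> \<Longrightarrow> subgroup (star_set A X Y) (add_monoid A)"
  unfolding star_set_def
  by (rule group.generate_is_subgroup[OF a_group]) (auto simp: star_closed subset_iff)

end

section \<open>Quotients\<close>

locale brace_quotient = left_brace +
  fixes I
  assumes ideal: "brace_ideal I A"
begin

lemma subgroup_ideal: "subgroup I (add_monoid A)"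
  using ideal by (simp add: brace_ideal_def subbrace_def)

lemma ideal_closed: "i \<in> I \<Longrightarrow> i \<in> carrier A"
  using subgroup.mem_carrier[OF subgroup_ideal] by simp

lemma ideal_add: "\<lbrakk>i \<in> I; j \<in> I\<rbrakk> \<Longrightarrow> i \<oplus> j \<in> I"
  using subgroup.m_closed[OF subgroup_ideal] by simp

lemma abelian_subgroup_ideal: "abelian_subgroup I A"
  by (rule abelian_subgroupI2[OF a_comm_group subgroup_ideal])

lemma lam_ideal: "\<lbrakk>a \<in> carrier A; i \<in> I\<rbrakk> \<Longrightarrow> lam A a i \<in> I"
  using brace_ideal_star(1)[OF ideal] by (simp add: lam_eq_add_star ideal_closed ideal_add)

text \<open>
Additive cosets of an ideal are also multiplicative cosets: \<open>i + a = ai'\<close> with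
\<open>i' = \<lambda>\<^sub>a\<^sup>-\<^sup>1(i) \<in> I\<close>. The factor \<open>i'\<close> is moved past \<open>j + b\<close> at the cost of an element of \<open>I\<close>, and
\<open>\<lambda>\<^sub>a\<close> carries that element back into \<open>I\<close>.
\<close>
lemma mult_coset:
  assumes a: "a \<in> carrier A" and b: "b \<in> carrier A" and i: "i \<in> I" and j: "j \<in> I"
  shows "\<exists>k \<in> I. (i \<oplus> a) \<otimes> (j \<oplus> b) = k \<oplus> a \<otimes> b"
proof -
  define i' where "i' = lam A (inv a) i"
  have i': "i' \<in> I" unfolding i'_def using a i by (intro lam_ideal) simp_all
  note cl = a b i[THEN ideal_closed] j[THEN ideal_closed] i'[THEN ideal_closed]
  have ia: "i \<oplus> a = a \<otimes> i'"
    unfolding i'_def using cl by (simp add: mult_eq_add_lam lam_closed lam_inv_cancel a_comm)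
  define k where "k = i' \<oplus> j \<oplus> star A i' (j \<oplus> b)"
  have k: "k \<in> I"
    unfolding k_def using cl i' j by (intro ideal_add brace_ideal_star(2)[OF ideal]) simp_all
  have "i' \<otimes> (j \<oplus> b) = b \<oplus> k"
    unfolding k_def using cl by (simp add: mult_eq_add_lam lam_eq_add_star star_closed a_ac)
  then have "(i \<oplus> a) \<otimes> (j \<oplus> b) = a \<otimes> (b \<oplus> k)"
    unfolding ia using cl by (simp add: m_assoc)
  also have "\<dots> = lam A a k \<oplus> a \<otimes> b"
    using cl ideal_closed[OF k] by (simp add: mult_eq_add_lam lam_add lam_closed a_ac)
  finally show ?thesis using lam_ideal[OF a k] by blast
qed


lemma mem_coset_iff: "y \<in> I +> x \<longleftrightarrow> (\<exists>i \<in> I. y = i \<oplus> x)"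
  by (auto simp: a_r_coset_def')

lemma coset_eq_iff:
  assumes "x \<in> carrier A" "y \<in> carrier A"
  shows "I +> x = I +> y \<longleftrightarrow> x \<ominus> y \<in> I"
proof
  assume "I +> x = I +> y"
  then obtain i where i: "i \<in> I" "x = i \<oplus> y"
    using mem_coset_iff abelian_subgroup.a_rcos_self[OF abelian_subgroup_ideal assms(1)] by auto
  then have "x \<ominus> y = i" using assms ideal_closed by (simp add: a_minus_def a_assoc r_neg)
  with i show "x \<ominus> y \<in> I" by simp
next
  assume "x \<ominus> y \<in> I"
  moreover have "x = (x \<ominus> y) \<oplus> y" using assms add_minus_cancel[of x y] by (simp add: a_comm)
  ultimately have "x \<in> I +> y" using mem_coset_iff by blast
  then show "I +> x = I +> y"
    using a_repr_independence[OF _ assms(2) subgroup_ideal] by metis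
qed

lemma quot_mult:
  assumes "x \<in> carrier A" "y \<in> carrier A"
  shows "(I +> x) \<otimes>\<^bsub>A Quot I\<^esub> (I +> y) = I +> (x \<otimes> y)"
proof -
  have const: "I +> (a \<otimes> b) = I +> (x \<otimes> y)" if ab: "a \<in> I +> x" "b \<in> I +> y" for a b
  proof -
    obtain k where "k \<in> I" "a \<otimes> b = k \<oplus> x \<otimes> y"
      using mult_coset[OF assms] ab mem_coset_iff by metis
    then have "a \<otimes> b \<in> I +> (x \<otimes> y)" using mem_coset_iff by blast
    then show ?thesis using a_repr_independence[OF _ _ subgroup_ideal] assms by simp
  qed
  have self: "x \<in> I +> x" "y \<in> I +> y"
    using assms abelian_subgroup.a_rcos_self[OF abelian_subgroup_ideal] by blast+
  have "rcoset_mult A I (I +> x) (I +> y) = I +> (x \<otimes> y)"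
    unfolding rcoset_mult_def by (rule UN_constant_eq[OF self(1)]) (auto intro!: UN_constant_eq[OF self(2)] const)
  then show ?thesis by (simp add: FactRing_def)
qed

lemma quot_add:
  assumes "x \<in> carrier A" "y \<in> carrier A"
  shows "(I +> x) \<oplus>\<^bsub>A Quot I\<^esub> (I +> y) = I +> (x \<oplus> y)"
  using abelian_subgroup.a_rcos_sum[OF abelian_subgroup_ideal assms] by (simp add: FactRing_def)

lemma quot_zero: "I +> \<zero> = \<zero>\<^bsub>A Quot I\<^esub>"
  using subgroup.subset[OF subgroup_ideal] by (simp add: FactRing_def)

lemma coset_eq_zero_iff:
  assumes "x \<in> carrier A"
  shows "I +> x = \<zero>\<^bsub>A Quot I\<^esub> \<longleftrightarrow> x \<in> I"
proof -
  have "x \<ominus> \<zero> = x" using add_minus_cancel[OF assms zero_closed] assms by simp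
  then show ?thesis using coset_eq_iff[OF assms zero_closed] by (simp add: quot_zero)
qed

lemma quot_carrier: "carrier (A Quot I) = (+>) I ` carrier A"
  by (auto simp: FactRing_def A_RCOSETS_def')

end

section \<open>Homomorphic images\<close>

text \<open>
That the target is a left brace is a conclusion: the brace laws pass along a surjection that
preserves the operations. Applied to the projection onto cosets, this yields the quotient brace.
\<close>
locale brace_epimorphism = left_brace A for A (structure) +
  fixes B :: "('b, 'n) ring_scheme" and h
  assumes h_add: "\<lbrakk>x \<in> carrier A; y \<in> carrier A\<rbrakk> \<Longrightarrow> h (x \<oplus> y) = h x \<oplus>\<^bsub>B\<^esub> h y"
    and h_mult: "\<lbrakk>x \<in> carrier A; y \<in> carrier A\<rbrakk> \<Longrightarrow> h (x \<otimes> y) = h x \<otimes>\<^bsub>B\<^esub> h y"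
    and h_zero: "h \<zero> = \<zero>\<^bsub>B\<^esub>"
    and h_one: "h \<one> = \<one>\<^bsub>B\<^esub>"
    and h_image: "carrier B = h ` carrier A"
begin

lemma h_closed: "x \<in> carrier A \<Longrightarrow> h x \<in> carrier B"
  by (simp add: h_image)

lemma abelian_group_image: "abelian_group B"
proof (rule abelian_groupI)
  show "\<exists>y \<in> carrier B. y \<oplus>\<^bsub>B\<^esub> x = \<zero>\<^bsub>B\<^esub>" if "x \<in> carrier B" for x
  proof -
    obtain a where a: "x = h a" "a \<in> carrier A" using \<open>x \<in> carrier B\<close> unfolding h_image by (rule imageE)
    have "h (\<ominus> a) \<oplus>\<^bsub>B\<^esub> x = \<zero>\<^bsub>B\<^esub>"
      using a h_add[of "\<ominus> a" a] by (simp add: l_neg h_zero)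
    then show ?thesis using a h_closed a_inv_closed by blast
  qed
qed (auto simp: h_image h_add[symmetric] h_zero[symmetric] a_ac)

lemma group_image: "group B"
proof (rule groupI)
  show "\<exists>y \<in> carrier B. y \<otimes>\<^bsub>B\<^esub> x = \<one>\<^bsub>B\<^esub>" if "x \<in> carrier B" for x
  proof -
    obtain a where a: "x = h a" "a \<in> carrier A" using \<open>x \<in> carrier B\<close> unfolding h_image by (rule imageE)
    have "h (inv a) \<otimes>\<^bsub>B\<^esub> x = \<one>\<^bsub>B\<^esub>"
      using a h_mult[of "inv a" a] by (simp add: h_one)
    then show ?thesis using a h_closed inv_closed by blast
  qed
qed (auto simp: h_image h_mult[symmetric] h_one[symmetric] m_assoc)

lemma h_neg: "x \<in> carrier A \<Longrightarrow> h (\<ominus> x) = \<ominus>\<^bsub>B\<^esub> h x"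
  using abelian_group.minus_equality[OF abelian_group_image, of "h (\<ominus> x)" "h x"]
    h_add[of "\<ominus> x" x] by (simp add: l_neg h_zero h_closed)

lemma h_minus: "\<lbrakk>x \<in> carrier A; y \<in> carrier A\<rbrakk> \<Longrightarrow> h (x \<ominus> y) = h x \<ominus>\<^bsub>B\<^esub> h y"
  by (simp add: a_minus_def h_add h_neg)

lemma left_brace_image: "left_brace B"
proof -
  have "a \<otimes>\<^bsub>B\<^esub> (b \<oplus>\<^bsub>B\<^esub> c) = a \<otimes>\<^bsub>B\<^esub> b \<oplus>\<^bsub>B\<^esub> a \<otimes>\<^bsub>B\<^esub> c \<ominus>\<^bsub>B\<^esub> a"
    if "a \<in> carrier B" "b \<in> carrier B" "c \<in> carrier B" for a b c
    using that unfolding h_image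
    by (auto simp: h_add[symmetric] h_mult[symmetric] h_minus[symmetric] brace_distr)
  then show ?thesis
    by (intro left_brace.intro abelian_group_image group_image left_brace_axioms.intro)
qed

lemma hom_add: "h \<in> hom (add_monoid A) (add_monoid B)"
  by (simp add: hom_def h_add h_closed)

lemma h_smult: "x \<in> carrier A \<Longrightarrow> h ([(k::int)] \<cdot> x) = [k] \<cdot>\<^bsub>B\<^esub> h x"
  using hom_int_pow[OF hom_add _ a_group abelian_group.a_group[OF abelian_group_image], of x k]
  by (simp add: add_pow_def)

lemma h_star: "\<lbrakk>x \<in> carrier A; y \<in> carrier A\<rbrakk> \<Longrightarrow> h (star A x y) = star B (h x) (h y)"
  by (simp add: star_def h_minus h_mult)

lemma subgroup_image:
  assumes "subgroup X (add_monoid A)"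
  shows "subgroup (h ` X) (add_monoid B)"
proof -
  interpret hom: group_hom "add_monoid A" "add_monoid B" h
    by (intro group_hom.intro group_hom_axioms.intro hom_add a_group
        abelian_group.a_group[OF abelian_group_image])
  show ?thesis by (rule hom.subgroup_img_is_subgroup[OF assms])
qed

lemma subgroup_preimage:
  assumes "subgroup Y (add_monoid B)"
  shows "subgroup {x \<in> carrier A. h x \<in> Y} (add_monoid A)"
proof (rule add.subgroupI)
  show "{x \<in> carrier A. h x \<in> Y} \<noteq> {}" using subgroup.one_closed[OF assms] h_zero by auto
  show "\<ominus> a \<in> {x \<in> carrier A. h x \<in> Y}" if "a \<in> {x \<in> carrier A. h x \<in> Y}" for a
    using that subgroup.m_inv_closed[OF assms, folded a_inv_def] by (auto simp: h_neg)
  show "a \<oplus> b \<in> {x \<in> carrier A. h x \<in> Y}"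
    if "a \<in> {x \<in> carrier A. h x \<in> Y}" "b \<in> {x \<in> carrier A. h x \<in> Y}" for a b
    using that subgroup.m_closed[OF assms] by (auto simp: h_add)
qed auto

lemma star_set_image:
  assumes "X \<subseteq> carrier A" "Y \<subseteq> carrier A"
  shows "star_set B (h ` X) (h ` Y) = h ` star_set A X Y"
proof
  interpret B: left_brace B by (rule left_brace_image)
  show "star_set B (h ` X) (h ` Y) \<subseteq> h ` star_set A X Y"
  proof (rule B.star_set_minimal[OF subgroup_image[OF subgroup_star_set[OF assms]]])
    fix u v assume "u \<in> h ` X" "v \<in> h ` Y"
    then obtain x y where "x \<in> X" "y \<in> Y" "u = h x" "v = h y" by blast
    moreover have "x \<in> carrier A" "y \<in> carrier A" using assms \<open>x \<in> X\<close> \<open>y \<in> Y\<close> by auto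
    ultimately show "star B u v \<in> h ` star_set A X Y"
      using star_setI[of x X y Y] by (simp flip: h_star)
  qed
  define P where "P = {z \<in> carrier A. h z \<in> star_set B (h ` X) (h ` Y)}"
  have sub: "subgroup (star_set B (h ` X) (h ` Y)) (add_monoid B)"
    using assms h_closed by (intro B.subgroup_star_set) auto
  have P: "subgroup P (add_monoid A)" unfolding P_def by (rule subgroup_preimage[OF sub])
  have "star_set A X Y \<subseteq> P"
  proof (rule star_set_minimal[OF P])
    fix x y assume xy: "x \<in> X" "y \<in> Y"
    then have cl: "x \<in> carrier A" "y \<in> carrier A" using assms by auto
    have "star B (h x) (h y) \<in> star_set B (h ` X) (h ` Y)" using xy by (intro B.star_setI) auto
    then show "star A x y \<in> P" unfolding P_def using cl by (simp add: h_star star_closed)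
  qed
  then show "h ` star_set A X Y \<subseteq> star_set B (h ` X) (h ` Y)" unfolding P_def by blast
qed

text \<open>
The preimage of a subbrace is a subbrace, hence an ideal, and its image is the given subbrace.
\<close>
lemma dedekind_image:
  assumes "dedekind_brace A"
  shows "dedekind_brace B"
  unfolding dedekind_brace_def
proof (intro conjI allI impI)
  interpret B: left_brace B by (rule left_brace_image)
  show "left_brace B" by (rule left_brace_image)
  fix S assume S: "subbrace S B"
  then have S_add: "subgroup S (add_monoid B)" and S_mult: "subgroup S B"
    unfolding subbrace_def by auto
  define P where "P = {z \<in> carrier A. h z \<in> S}"
  have "subgroup P (add_monoid A)" unfolding P_def by (rule subgroup_preimage[OF S_add])
  moreover have "subgroup P A"
  proof (rule subgroupI)
    show "P \<subseteq> carrier A" unfolding P_def by blast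
    show "P \<noteq> {}" using subgroup.one_closed[OF S_mult] h_one unfolding P_def by auto
    show "inv a \<in> P" if "a \<in> P" for a
    proof -
      have a: "a \<in> carrier A" "h a \<in> S" using that unfolding P_def by auto
      have "h (inv a) = inv\<^bsub>B\<^esub> h a"
        using a(1) h_mult[of "inv a" a] by (intro B.inv_equality[symmetric]) (simp_all add: h_one h_closed)
      then show ?thesis using a subgroup.m_inv_closed[OF S_mult] unfolding P_def by simp
    qed
    show "a \<otimes> b \<in> P" if "a \<in> P" "b \<in> P" for a b
      using that subgroup.m_closed[OF S_mult] unfolding P_def by (auto simp: h_mult)
  qed
  ultimately have ideal: "brace_ideal P A"
    using assms unfolding dedekind_brace_def subbrace_def by blast
  have star: "star B x s \<in> S \<and> star B s x \<in> S" if "x \<in> carrier B" "s \<in> S" for x s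
  proof -
    obtain a where a: "x = h a" "a \<in> carrier A" using \<open>x \<in> carrier B\<close> unfolding h_image by (rule imageE)
    obtain p where p: "p \<in> P" "s = h p"
      using \<open>s \<in> S\<close> subgroup.mem_carrier[OF S_mult] h_image unfolding P_def by auto
    then have "p \<in> carrier A" unfolding P_def by blast
    then show ?thesis
      using brace_ideal_star[OF ideal p(1) a(2)] a p unfolding P_def by (simp add: h_star)
  qed
  show "brace_ideal S B"
    unfolding brace_ideal_def
  proof (intro conjI S)
    show "star_set B (carrier B) S \<subseteq> S" by (rule B.star_set_minimal[OF S_add]) (rule star[THEN conjunct1])
    show "star_set B S (carrier B) \<subseteq> S" by (rule B.star_set_minimal[OF S_add]) (rule star[THEN conjunct2])
  qed
qed

lemma brace_centre_image: "h ` brace_centre A \<subseteq> brace_centre B"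
  unfolding brace_centre_def h_image by (auto simp: h_add[symmetric] h_mult[symmetric])

end

sublocale brace_quotient \<subseteq> proj: brace_epimorphism A "A Quot I" "(+>) I"
proof
  show "I +> \<one> = \<one>\<^bsub>A Quot I\<^esub>" by (simp add: FactRing_def)
qed (simp_all add: quot_add quot_mult quot_zero quot_carrier)

section \<open>Dedekind braces that coincide with their second socle\<close>

text \<open>
In the braces below this is the subbrace generated by \<open>x\<close>.
\<close>
definition cyclic_hull :: "('a, 'm) ring_scheme \<Rightarrow> 'a \<Rightarrow> 'a set" where
  "cyclic_hull A x = {[u] \<cdot>\<^bsub>A\<^esub> x \<oplus>\<^bsub>A\<^esub> [v] \<cdot>\<^bsub>A\<^esub> star A x x | (u::int) (v::int). True}"

text \<open>
The second assumption is the elementwise form of \<open>A = Soc\<^sub>2(A)\<close>: the quotient by the socle has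
trivial star operation (see \<open>dedekind_soc2I\<close>).
\<close>
locale dedekind_soc2 = left_brace +
  assumes ideal_of_subbrace: "subbrace S A \<Longrightarrow> brace_ideal S A"
    and star_Soc: "\<lbrakk>a \<in> carrier A; b \<in> carrier A\<rbrakk> \<Longrightarrow> star A a b \<in> Soc A"
begin

text \<open>
The elements \<open>ab\<close> and \<open>a + b\<close> differ by \<open>a \<ast> b\<close>, which lies in the socle and so does not affect
the action. Hence \<open>\<lambda>\<close> is a homomorphism on the additive group as well.
\<close>
lemma lam_add_left:
  assumes "a \<in> carrier A" "b \<in> carrier A" "x \<in> carrier A"
  shows "lam A (a \<oplus> b) x = lam A a (lam A b x)"
proof -
  have "a \<otimes> b = star A a b \<oplus> (a \<oplus> b)"
    using assms by (simp add: mult_eq_add_lam lam_eq_add_star star_closed a_ac)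
  then show ?thesis
    using assms lam_Soc_add[OF star_Soc, of a b "a \<oplus> b" x] by (simp flip: lam_lam)
qed

lemma lam_uminus_cancel:
  assumes "a \<in> carrier A" "x \<in> carrier A"
  shows "lam A (\<ominus> a) (lam A a x) = x"
  using assms lam_add_left[of "\<ominus> a" a x] by (simp add: l_neg lam_one)

text \<open>
Products are obtained from \<open>xy = x + y + x \<ast> y\<close>. For inverses, additivity of \<open>\<lambda>\<close> gives
\<open>a\<^sup>-\<^sup>1 = \<lambda>\<^sub>-\<^sub>a(-a)\<close>, which involves only the additive inverse.
\<close>
lemma subbrace_if_star_closed:
  assumes X: "subgroup X (add_monoid A)"
    and star: "\<And>x y. \<lbrakk>x \<in> X; y \<in> X\<rbrakk> \<Longrightarrow> star A x y \<in> X"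
  shows "subbrace X A"
  unfolding subbrace_def
proof
  have cl: "x \<in> carrier A" if "x \<in> X" for x using subgroup.mem_carrier[OF X that] by simp
  have add: "x \<oplus> y \<in> X" if "x \<in> X" "y \<in> X" for x y using subgroup.m_closed[OF X that] by simp
  have lam: "lam A x y \<in> X" if "x \<in> X" "y \<in> X" for x y
    using that by (simp add: lam_eq_add_star cl add star)
  show "subgroup X A"
  proof (rule subgroupI)
    show "X \<subseteq> carrier A" using cl by blast
    show "X \<noteq> {}" using subgroup.one_closed[OF X] by blast
    show "a \<otimes> b \<in> X" if "a \<in> X" "b \<in> X" for a b
      using that by (simp add: mult_eq_add_lam cl add lam)
    show "inv a \<in> X" if a: "a \<in> X" for a
    proof -
      have neg: "\<ominus> a \<in> X" using subgroup.m_inv_closed[OF X a, folded a_inv_def] .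
      have "a \<oplus> lam A a (inv a) = \<zero>"
        using cl[OF a] mult_eq_add_lam[of a "inv a"] zero_eq_one by simp
      then have "lam A a (inv a) = \<ominus> a"
        using cl[OF a] by (metis a_comm inv_closed lam_closed minus_equality)
      then have "inv a = lam A (\<ominus> a) (\<ominus> a)"
        using lam_uminus_cancel[of a "inv a"] cl[OF a] by simp
      then show ?thesis using lam[OF neg neg] by simp
    qed
  qed
qed (rule X)

text \<open>
Cyclic subgroups of the socle are subbraces, hence ideals. So \<open>A\<close> acts on the socle by
automorphisms that map every element to one of its multiples.
\<close>
lemma lam_Soc_multiple:
  assumes a: "a \<in> carrier A" and s: "s \<in> Soc A"
  obtains k :: int where "lam A a s = [k] \<cdot> s"
proof -
  have "multiples A s \<subseteq> Soc A" by (rule multiples_subset[OF subgroup_Soc s])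
  then have "brace_ideal (multiples A s) A"
    by (intro ideal_of_subbrace subbrace_of_Soc subgroup_multiples Soc_closed s)
  moreover have "s \<in> multiples A s" using multiplesI[of 1 s] Soc_closed[OF s] by (simp add: one_smult)
  ultimately have "star A a s \<in> multiples A s" using brace_ideal_star a by blast
  then obtain k :: int where "star A a s = [k] \<cdot> s" by (rule multiplesE)
  then have "lam A a s = [(1 + k)] \<cdot> s"
    using a s Soc_closed by (simp add: lam_eq_add_star add_smult one_smult)
  then show ?thesis by (rule that)
qed

lemma cyclic_hullI: "[(u::int)] \<cdot> x \<oplus> [(v::int)] \<cdot> star A x x \<in> cyclic_hull A x"
  unfolding cyclic_hull_def by blast

lemma cyclic_hullE:
  assumes "y \<in> cyclic_hull A x"
  obtains u v :: int where "y = [u] \<cdot> x \<oplus> [v] \<cdot> star A x x"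
  using assms unfolding cyclic_hull_def by blast

lemma subgroup_cyclic_hull:
  assumes x: "x \<in> carrier A"
  shows "subgroup (cyclic_hull A x) (add_monoid A)"
proof (rule add.subgroupI)
  note t = star_closed[OF x x]
  show "cyclic_hull A x \<subseteq> carrier A" unfolding cyclic_hull_def using x t by (auto simp: smult_closed)
  show "cyclic_hull A x \<noteq> {}" using cyclic_hullI by blast
  show "\<ominus> a \<in> cyclic_hull A x" if a: "a \<in> cyclic_hull A x" for a
  proof -
    obtain u v :: int where "a = [u] \<cdot> x \<oplus> [v] \<cdot> star A x x" using a by (rule cyclic_hullE)
    then have "\<ominus> a = [(- u)] \<cdot> x \<oplus> [(- v)] \<cdot> star A x x"
      using x t by (simp add: neg_smult minus_add smult_closed)
    then show ?thesis using cyclic_hullI by simp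
  qed
  show "a \<oplus> b \<in> cyclic_hull A x" if ab: "a \<in> cyclic_hull A x" "b \<in> cyclic_hull A x" for a b
  proof -
    obtain u v :: int where "a = [u] \<cdot> x \<oplus> [v] \<cdot> star A x x" using ab(1) by (rule cyclic_hullE)
    moreover obtain u' v' :: int where "b = [u'] \<cdot> x \<oplus> [v'] \<cdot> star A x x" using ab(2) by (rule cyclic_hullE)
    ultimately have "a \<oplus> b = [(u + u')] \<cdot> x \<oplus> [(v + v')] \<cdot> star A x x"
      using x t by (simp add: add_smult smult_closed a_ac)
    then show ?thesis using cyclic_hullI by simp
  qed
qed

lemma cyclic_hull_closed: "\<lbrakk>x \<in> carrier A; y \<in> cyclic_hull A x\<rbrakk> \<Longrightarrow> y \<in> carrier A"
  using subgroup.mem_carrier[OF subgroup_cyclic_hull] by simp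

lemma star_self_in_cyclic_hull: "x \<in> carrier A \<Longrightarrow> star A x x \<in> cyclic_hull A x"
  using cyclic_hullI[of 0 x 1] by (simp add: zero_smult one_smult star_closed)

lemma self_in_cyclic_hull: "x \<in> carrier A \<Longrightarrow> x \<in> cyclic_hull A x"
  using cyclic_hullI[of 1 x 0] by (simp add: zero_smult one_smult)

lemma lam_cyclic_hullI:
  assumes x: "x \<in> carrier A" and a: "a \<in> carrier A"
    and gen: "lam A a x \<in> cyclic_hull A x" and y: "y \<in> cyclic_hull A x"
  shows "lam A a y \<in> cyclic_hull A x"
proof -
  note t = star_closed[OF x x]
  obtain u v :: int where y: "y = [u] \<cdot> x \<oplus> [v] \<cdot> star A x x" using y by (rule cyclic_hullE)
  obtain k :: int where k: "lam A a (star A x x) = [k] \<cdot> star A x x"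
    using lam_Soc_multiple[OF a star_Soc[OF x x]] .
  have "lam A a y = [u] \<cdot> lam A a x \<oplus> [v] \<cdot> ([k] \<cdot> star A x x)"
    unfolding y using x a t by (simp add: lam_add lam_smult smult_closed k)
  moreover have "[u] \<cdot> lam A a x \<in> cyclic_hull A x" "[v] \<cdot> ([k] \<cdot> star A x x) \<in> cyclic_hull A x"
    by (intro subgroup_smult[OF subgroup_cyclic_hull[OF x]] gen star_self_in_cyclic_hull x)+
  ultimately show ?thesis using subgroup.m_closed[OF subgroup_cyclic_hull[OF x]] by simp
qed

text \<open>
It suffices to treat \<open>\<lambda>\<^sub>x\<close> and its inverse \<open>\<lambda>\<^sub>-\<^sub>x\<close>. Both map \<open>x\<close> to \<open>x\<close> plus a multiple of
\<open>x \<ast> x\<close>, and both map \<open>x \<ast> x\<close> to a multiple of itself.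
\<close>
lemma lam_smult_cyclic_hull:
  assumes x: "x \<in> carrier A" and y: "y \<in> cyclic_hull A x"
  shows "lam A ([(k::int)] \<cdot> x) y \<in> cyclic_hull A x"
proof (induction k rule: int_induct[where k = 0])
  case base
  then show ?case using y cyclic_hull_closed[OF x y] by (simp add: zero_smult lam_one)
next
  case (step1 i)
  have gen: "lam A x x \<in> cyclic_hull A x" using cyclic_hullI[of 1 x 1] x by (simp add: lam_eq_add_star one_smult star_closed)
  have "lam A x (lam A ([i] \<cdot> x) y) \<in> cyclic_hull A x" by (rule lam_cyclic_hullI[OF x x gen step1.IH])
  moreover have "[(i + 1)] \<cdot> x = x \<oplus> [i] \<cdot> x"
    using x by (simp add: add_smult one_smult smult_closed a_comm)
  ultimately show ?case using x cyclic_hull_closed[OF x y] by (simp add: lam_add_left smult_closed)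
next
  case (step2 i)
  note t = star_closed[OF x x]
  have nx: "\<ominus> x \<in> carrier A" using x by simp
  obtain k :: int where k: "lam A (\<ominus> x) (star A x x) = [k] \<cdot> star A x x"
    using lam_Soc_multiple[OF nx star_Soc[OF x x]] .
  have "x = lam A (\<ominus> x) (x \<oplus> star A x x)"
    using lam_uminus_cancel[OF x x] x by (simp add: lam_eq_add_star)
  also have "\<dots> = lam A (\<ominus> x) x \<oplus> [k] \<cdot> star A x x"
    using x t by (simp add: lam_add k)
  finally have eq: "lam A (\<ominus> x) x \<oplus> [k] \<cdot> star A x x = x" ..
  have "lam A (\<ominus> x) x = (lam A (\<ominus> x) x \<oplus> [k] \<cdot> star A x x) \<oplus> \<ominus> ([k] \<cdot> star A x x)"
    using x t nx by (simp add: a_assoc r_neg lam_closed smult_closed)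
  then have "lam A (\<ominus> x) x = [(1::int)] \<cdot> x \<oplus> [(- k)] \<cdot> star A x x"
    unfolding eq using x t by (simp add: neg_smult)
  then have gen: "lam A (\<ominus> x) x \<in> cyclic_hull A x" using cyclic_hullI[of 1 x "- k"] by simp
  have "lam A (\<ominus> x) (lam A ([i] \<cdot> x) y) \<in> cyclic_hull A x" by (rule lam_cyclic_hullI[OF x nx gen step2.IH])
  moreover have "[(i - 1)] \<cdot> x = \<ominus> x \<oplus> [i] \<cdot> x"
    using x by (simp add: diff_smult one_smult smult_closed a_comm a_minus_def)
  ultimately show ?case using x nx cyclic_hull_closed[OF x y] by (simp add: lam_add_left smult_closed)
qed

lemma subbrace_cyclic_hull:
  assumes x: "x \<in> carrier A"
  shows "subbrace (cyclic_hull A x) A"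
proof (rule subbrace_if_star_closed[OF subgroup_cyclic_hull[OF x]])
  fix y z assume y: "y \<in> cyclic_hull A x" and z: "z \<in> cyclic_hull A x"
  note t = star_closed[OF x x]
  obtain u v :: int where uv: "y = [u] \<cdot> x \<oplus> [v] \<cdot> star A x x" using y by (rule cyclic_hullE)
  have "lam A y z = lam A ([v] \<cdot> star A x x \<oplus> [u] \<cdot> x) z"
    unfolding uv using x t by (simp add: smult_closed a_comm)
  also have "\<dots> = lam A ([u] \<cdot> x) z"
    using x cyclic_hull_closed[OF x z]
    by (intro lam_Soc_add subgroup_smult[OF subgroup_Soc] star_Soc) (auto simp: smult_closed)
  finally have "lam A y z \<in> cyclic_hull A x" using lam_smult_cyclic_hull[OF x z] by simp
  then show "star A y z \<in> cyclic_hull A x"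
    using cyclic_hull_closed[OF x] y z by (simp add: star_eq subgroup_minus[OF subgroup_cyclic_hull[OF x]])
qed

text \<open>
This is how the Dedekind property is used from now on.
\<close>
lemma star_in_cyclic_hull:
  assumes "x \<in> carrier A" "a \<in> carrier A"
  shows "star A x a \<in> cyclic_hull A x" "star A a x \<in> cyclic_hull A x"
  by (rule brace_ideal_star[OF ideal_of_subbrace[OF subbrace_cyclic_hull[OF assms(1)]]
        self_in_cyclic_hull[OF assms(1)] assms(2)])+

end

lemma dedekind_soc2I:
  fixes A :: "('a, 'm) ring_scheme"
  assumes ded: "dedekind_brace A" and soc2: "carrier A = Soc2 A"
  shows "dedekind_soc2 A"
proof -
  interpret left_brace A using ded by (simp add: dedekind_brace_def)
  have ideal: "brace_ideal S A" if "subbrace S A" for S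
    using ded that by (simp add: dedekind_brace_def)
  interpret Q: brace_quotient A "Soc A"
    by unfold_locales (intro ideal subbrace_of_Soc subgroup_Soc subset_refl)
  have "star A a b \<in> Soc A" if a: "a \<in> carrier A" and b: "b \<in> carrier A" for a b
  proof -
    have "Soc A +>\<^bsub>A\<^esub> a \<in> Soc (A Quot Soc A)" using a soc2 unfolding Soc2_def by blast
    then have "star (A Quot Soc A) (Soc A +>\<^bsub>A\<^esub> a) (Soc A +>\<^bsub>A\<^esub> b) = \<zero>\<^bsub>A Quot Soc A\<^esub>"
      using Q.proj.h_closed[OF b] unfolding Soc_def[of "A Quot Soc A"] by blast
    then have "Soc A +>\<^bsub>A\<^esub> star A a b = \<zero>\<^bsub>A Quot Soc A\<^esub>"
      by (simp add: Q.proj.h_star[OF a b])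
    then show ?thesis using Q.coset_eq_zero_iff[OF star_closed[OF a b]] by blast
  qed
  then show ?thesis
    by (intro dedekind_soc2.intro dedekind_soc2_axioms.intro left_brace_axioms ideal)
      (use ded in \<open>simp add: dedekind_brace_def\<close>)
qed

section \<open>The action on a non-periodic socle\<close>

context dedekind_soc2
begin

text \<open>
With a torsion \<open>a \<ast> a\<close> this confines the elements \<open>\<lambda>\<^sub>n\<^sub>a(a)\<close> to a finite set, so that two of
them must coincide.
\<close>
lemma lam_smult_self_in_coset:
  assumes a: "a \<in> carrier A"
  shows "\<exists>w \<in> multiples A (star A a a). lam A ([(int n)] \<cdot> a) a = a \<oplus> w"
proof (induction n)
  case 0
  have "\<zero> \<in> multiples A (star A a a)" using multiplesI[of 0] by (simp add: zero_smult)
  then show ?case using a by (intro bexI[of _ \<zero>]) (simp_all add: zero_smult lam_one)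
next
  case (Suc n)
  let ?t = "star A a a"
  note t = star_closed[OF a a]
  obtain w where w: "w \<in> multiples A ?t" "lam A ([(int n)] \<cdot> a) a = a \<oplus> w" using Suc by blast
  obtain k :: int where k: "w = [k] \<cdot> ?t" using w(1) by (rule multiplesE)
  obtain j :: int where j: "lam A a ?t = [j] \<cdot> ?t" using lam_Soc_multiple[OF a star_Soc[OF a a]] .
  have "[(int (Suc n))] \<cdot> a = a \<oplus> [(int n)] \<cdot> a"
    using a add_smult[OF a, of 1 "int n"] by simp
  then have "lam A ([(int (Suc n))] \<cdot> a) a = lam A a (a \<oplus> [k] \<cdot> ?t)"
    using a w(2) k by (simp add: lam_add_left smult_closed)
  also have "\<dots> = (a \<oplus> ?t) \<oplus> [k] \<cdot> ([j] \<cdot> ?t)"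
    using a t by (simp add: lam_add lam_smult smult_closed j) (simp add: lam_eq_add_star)
  also have "\<dots> = a \<oplus> [(1 + k * j)] \<cdot> ?t"
    using a t by (simp add: add_smult smult_smult smult_closed a_assoc)
  finally show ?case using multiplesI by blast
qed

text \<open>
Suppose that the socle is periodic. Then \<open>\<lambda>\<^sub>n\<^sub>a(a)\<close> takes the same value for two different \<open>n\<close>, so
some nonzero multiple \<open>c\<close> of \<open>a\<close> satisfies \<open>\<lambda>\<^sub>c(a) = a\<close> and hence \<open>c \<ast> c = 0\<close>. Now
\<open>c \<ast> b\<close> lies both in the torsion-free group \<open>\<int>c\<close> and in the periodic socle, so it vanishes
for all \<open>b\<close>. Thus \<open>c\<close> is an element of the socle of infinite order, a contradiction.
\<close>
lemma Soc_not_torsion: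
  assumes a: "a \<in> carrier A" "\<not> torsion A a"
  shows "\<exists>s \<in> Soc A. \<not> torsion A s"
proof (rule ccontr)
  assume "\<not> ?thesis"
  then have tor: "torsion A s" if "s \<in> Soc A" for s using that by blast
  let ?t = "star A a a"
  note t = star_closed[OF a(1) a(1)]
  have "finite (multiples A ?t)" using finite_multiples[OF t] tor[OF star_Soc] a(1) by blast
  moreover have "range (\<lambda>n. lam A ([(int n)] \<cdot> a) a) \<subseteq> (\<oplus>) a ` multiples A ?t"
    using lam_smult_self_in_coset[OF a(1)] by blast
  ultimately have "finite (range (\<lambda>n. lam A ([(int n)] \<cdot> a) a))"
    by (meson finite_imageI finite_subset)
  then have "\<not> inj (\<lambda>n. lam A ([(int n)] \<cdot> a) a)" using finite_imageD by blast
  then obtain m n where mn: "lam A ([(int m)] \<cdot> a) a = lam A ([(int n)] \<cdot> a) a" "m \<noteq> n"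
    unfolding inj_def by blast
  define c where "c = [(int n - int m)] \<cdot> a"
  have c: "c \<in> carrier A" unfolding c_def using a(1) by (rule smult_closed)
  have nt: "\<not> torsion A c" unfolding c_def 
    using torsion_of_smult[OF a(1), of "int n - int m"] a(2) mn(2) by auto
  have "[(int n)] \<cdot> a = [(int m)] \<cdot> a \<oplus> c"
    unfolding c_def using add_smult[OF a(1), of "int m" "int n - int m"] by simp
  then have "lam A ([(int n)] \<cdot> a) a = lam A ([(int m)] \<cdot> a) (lam A c a)"
    using a(1) c by (simp add: lam_add_left smult_closed)
  then have "lam A c a = a"
    using mn(1) lam_inv_cancel(1)[of "[(int m)] \<cdot> a"] a(1) c lam_closed
    by (metis smult_closed)
  then have "lam A c c = c"
    using lam_smult[OF c a(1), of "int n - int m"] by (simp add: c_def)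
  then have cc: "star A c c = \<zero>" using c by (simp add: star_eq minus_eq_zero_iff)
  have "star A c b = \<zero>" if b: "b \<in> carrier A" for b
  proof -
    obtain u v :: int where "star A c b = [u] \<cdot> c \<oplus> [v] \<cdot> star A c c"
      using star_in_cyclic_hull(1)[OF c b] by (rule cyclic_hullE)
    then have u: "star A c b = [u] \<cdot> c" using c by (simp add: cc smult_zero smult_closed)
    have "torsion A ([u] \<cdot> c)" using tor[OF star_Soc[OF c b]] u by simp
    then have "u = 0" using torsion_of_smult[OF c] nt by blast
    then show ?thesis using u by (simp add: zero_smult)
  qed
  then have "c \<in> Soc A" using c unfolding Soc_def by blast
  then show False using tor nt by blast
qed

text \<open>
The factor \<open>k\<close> is read off at \<open>s0\<close>, where it is invertible in \<open>\<int>\<close>. For another \<open>s\<close> with factor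
\<open>j\<close>, let \<open>l\<close> be the factor of \<open>s0 + s\<close>. Comparing both sides of \<open>k s0 + j s = l (s0 + s)\<close>
gives \<open>(k - l) s0 = (l - j) s\<close>. Applying \<open>\<lambda>\<^sub>b\<close> multiplies the left side by \<open>k\<close> and the right side by
\<open>j\<close>, so \<open>(k - l)(k - j) = 0\<close>. Either case yields \<open>\<lambda>\<^sub>b(s) = k s\<close>.
\<close>
lemma lam_Soc_sign:
  assumes b: "b \<in> carrier A" and s0: "s0 \<in> Soc A" "\<not> torsion A s0"
  obtains k :: int where "k = 1 \<or> k = - 1" "\<And>s. s \<in> Soc A \<Longrightarrow> lam A b s = [k] \<cdot> s"
proof -
  have s0A: "s0 \<in> carrier A" using s0(1) by (rule Soc_closed)
  obtain k :: int where k: "lam A b s0 = [k] \<cdot> s0" using lam_Soc_multiple[OF b s0(1)] .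
  obtain k' :: int where k': "lam A (inv b) s0 = [k'] \<cdot> s0" 
    using lam_Soc_multiple[OF inv_closed[OF b] s0(1)] .
  have "s0 = lam A (inv b) ([k] \<cdot> s0)" using lam_inv_cancel(1)[OF b s0A] k by simp
  also have "\<dots> = [(k * k')] \<cdot> s0" using b s0A by (simp add: lam_smult k' smult_smult)
  finally have "[(1::int)] \<cdot> s0 = [(k * k')] \<cdot> s0" by (simp only: one_smult[OF s0A])
  then have "1 = k * k'" by (rule not_torsion_smult_eq[OF s0A s0(2)])
  then have unit: "k = 1 \<or> k = - 1" by (metis zmult_eq_1_iff)
  have "lam A b s = [k] \<cdot> s" if s: "s \<in> Soc A" for s
  proof -
    have sA: "s \<in> carrier A" using s by (rule Soc_closed)
    obtain j :: int where j: "lam A b s = [j] \<cdot> s" using lam_Soc_multiple[OF b s] .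
    have "s0 \<oplus> s \<in> Soc A" using subgroup.m_closed[OF subgroup_Soc s0(1) s] by simp
    then obtain l :: int where l: "lam A b (s0 \<oplus> s) = [l] \<cdot> (s0 \<oplus> s)"
      by (rule lam_Soc_multiple[OF b])
    have sum: "[k] \<cdot> s0 \<oplus> [j] \<cdot> s = [l] \<cdot> s0 \<oplus> [l] \<cdot> s"
      using l b s0A sA by (simp add: lam_add k j smult_add)
    have diff: "[(k - l)] \<cdot> s0 = [(l - j)] \<cdot> s"
      using add_eq_add_imp_minus_eq[OF _ _ _ _ sum] s0A sA by (simp add: diff_smult smult_closed)
    have "[((k - l) * k)] \<cdot> s0 = lam A b ([(k - l)] \<cdot> s0)"
      using b s0A by (simp add: lam_smult k smult_smult)
    also have "\<dots> = [((l - j) * j)] \<cdot> s"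
      unfolding diff using b sA by (simp add: lam_smult j smult_smult)
    also have "\<dots> = [j] \<cdot> ([(k - l)] \<cdot> s0)"
      unfolding diff using sA by (simp add: smult_smult mult.commute)
    also have "\<dots> = [(j * (k - l))] \<cdot> s0" using s0A by (simp add: smult_smult)
    finally have "(k - l) * k = j * (k - l)" by (rule not_torsion_smult_eq[OF s0A s0(2)])
    then have "k = l \<or> k = j" by (simp add: mult.commute)
    then show ?thesis
    proof
      assume "k = l"
      then have "[(l - j)] \<cdot> s = \<zero>" using diff by (simp add: zero_smult)
      then have "[l] \<cdot> s = [j] \<cdot> s" using smult_eq_iff[OF sA] by blast
      then show ?thesis using j \<open>k = l\<close> by simp
    qed (simp add: j)
  qed
  with unit show ?thesis by (rule that)
qed

text \<open>
Put \<open>t = b \<ast> b\<close>. Since \<open>\<lambda>\<^sub>b\<close> inverts all star products, \<open>\<lambda>\<^sub>2\<^sub>b = \<lambda>\<^sub>b\<^sup>2\<close> is the identity. So \<open>2b\<close> lies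
in the socle and is inverted as well, which gives \<open>4b = -2t\<close>. For \<open>x = b + jt\<close> one has
\<open>x \<ast> x = (1 - 2j)t\<close>, and \<open>x \<ast> s = -2s\<close> for \<open>s\<close> in the socle. As this lies in
\<open>\<int>x + \<int>(x \<ast> x)\<close>, multiplying by 4 to eliminate \<open>b\<close> shows that \<open>-8s\<close> is a multiple of
\<open>(1 - 2j)t\<close>, for every \<open>s\<close> in the socle and every \<open>j\<close>. With \<open>j = 0\<close> and \<open>s = s0\<close> this says that \<open>t\<close>
has infinite order. With \<open>j = 2\<close> and \<open>s = t\<close> it says that 3 divides 8.
\<close>
lemma lam_Soc_not_inversion:
  assumes b: "b \<in> carrier A" and s0: "s0 \<in> Soc A" "\<not> torsion A s0"
    and neg: "\<And>s. s \<in> Soc A \<Longrightarrow> lam A b s = \<ominus> s"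
  shows False
proof -
  define t where "t = star A b b"
  have t: "t \<in> carrier A" "t \<in> Soc A" unfolding t_def using b by (simp_all add: star_closed star_Soc)
  have lam_bb: "lam A b b = b \<oplus> t" unfolding t_def using b by (simp add: lam_eq_add_star)
  have "lam A (b \<oplus> b) x = x" if x: "x \<in> carrier A" for x
  proof -
    have "lam A (b \<oplus> b) x = lam A b (x \<oplus> star A b x)"
      by (simp only: lam_add_left[OF b b x] lam_eq_add_star[OF b x])
    also have "\<dots> = (x \<oplus> star A b x) \<oplus> \<ominus> star A b x"
      using b x neg[OF star_Soc[OF b x]] by (simp add: lam_add star_closed) (simp add: lam_eq_add_star)
    also have "\<dots> = x" using b x by (simp add: star_closed a_assoc r_neg)
    finally show ?thesis .
  qed
  then have "b \<oplus> b \<in> Soc A" using b by (simp add: Soc_iff_lam)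
  then have "lam A b (b \<oplus> b) = \<ominus> (b \<oplus> b)" by (rule neg)
  then have bt: "(b \<oplus> t) \<oplus> (b \<oplus> t) = \<ominus> (b \<oplus> b)" using b by (simp add: lam_add lam_bb)
  have two: "[(2::int)] \<cdot> x = x \<oplus> x" if "x \<in> carrier A" for x
    using add_smult[OF that, of 1 1] that by simp
  have "[(4::int)] \<cdot> b \<oplus> [(2::int)] \<cdot> t = \<zero>"
  proof -
    have "[(4::int)] \<cdot> b = (b \<oplus> b) \<oplus> (b \<oplus> b)" using add_smult[OF b, of 2 2] two[OF b] by simp
    then have "[(4::int)] \<cdot> b \<oplus> [(2::int)] \<cdot> t = ((b \<oplus> t) \<oplus> (b \<oplus> t)) \<oplus> (b \<oplus> b)"
      using b t by (simp add: two a_ac)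
    then show ?thesis unfolding bt using b by (simp add: l_neg)
  qed
  then have four_b: "[(4::int)] \<cdot> b = [(- 2::int)] \<cdot> t"
    using b t by (metis minus_equality neg_smult smult_closed)
  have key: "\<exists>m::int. [(- 8::int)] \<cdot> s = [(m * (1 - 2 * j))] \<cdot> t" if s: "s \<in> Soc A" for s and j :: int
  proof -
    have sA: "s \<in> carrier A" using s by (rule Soc_closed)
    define x where "x = b \<oplus> [j] \<cdot> t"
    have x: "x \<in> carrier A" unfolding x_def using b t by (simp add: smult_closed)
    \<comment> \<open>The element \<open>x\<close> is a translate of \<open>b\<close> by the socle, so it acts in the same way.\<close>
    have lam_x: "lam A x y = lam A b y" if "y \<in> carrier A" for y
    proof -
      have "lam A x y = lam A ([j] \<cdot> t \<oplus> b) y" unfolding x_def using b t by (simp add: smult_closed a_comm)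
      also have "\<dots> = lam A b y" using subgroup_smult[OF subgroup_Soc t(2)] b that by (rule lam_Soc_add)
      finally show ?thesis .
    qed
    have "star A x x = lam A b x \<ominus> x" using x by (simp add: star_eq lam_x)
    also have "lam A b x = x \<oplus> [(1 - 2 * j)] \<cdot> t"
    proof -
      have "lam A b x = (b \<oplus> t) \<oplus> [(- j)] \<cdot> t"
        unfolding x_def using b t by (simp add: lam_add lam_smult smult_closed lam_bb neg neg_smult smult_neg)
      also have "\<dots> = b \<oplus> [(1 - j)] \<cdot> t"
        using b t add_smult[OF t(1), of 1 "- j"] by (simp add: smult_closed a_assoc)
      also have "\<dots> = x \<oplus> [(1 - 2 * j)] \<cdot> t"
        unfolding x_def using b t add_smult[OF t(1), of j "1 - 2 * j"] by (simp add: smult_closed a_assoc)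
      finally show ?thesis .
    qed
    finally have xx: "star A x x = [(1 - 2 * j)] \<cdot> t"
      using x t by (simp add: a_minus_def smult_closed a_ac r_neg1 r_neg2)
    obtain u v :: int where uv: "star A x s = [u] \<cdot> x \<oplus> [v] \<cdot> star A x x"
      using star_in_cyclic_hull(1)[OF x sA] by (rule cyclic_hullE)
    have "star A x s = \<ominus> s \<oplus> \<ominus> s" using x sA by (simp add: star_eq lam_x neg[OF s] a_minus_def)
    also have "\<dots> = [(- 2::int)] \<cdot> s" using sA by (simp add: neg_smult two minus_add)
    finally have "[(- 2::int)] \<cdot> s = [u] \<cdot> x \<oplus> [v] \<cdot> ([(1 - 2 * j)] \<cdot> t)" using uv xx by simp
    then have "[(4::int)] \<cdot> ([(- 2::int)] \<cdot> s) = [(4::int)] \<cdot> ([u] \<cdot> x \<oplus> [v] \<cdot> ([(1 - 2 * j)] \<cdot> t))"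
      by simp
    also have "\<dots> = [u] \<cdot> ([(4::int)] \<cdot> x) \<oplus> [(4 * (v * (1 - 2 * j)))] \<cdot> t"
      using x t by (simp add: smult_add smult_closed smult_smult mult.commute)
    also have "[(4::int)] \<cdot> x = [(- 2 + 4 * j)] \<cdot> t"
      unfolding x_def add_smult[OF t(1)] using b t by (simp add: smult_add smult_closed smult_smult four_b)
    also have "[u] \<cdot> ([(- 2 + 4 * j)] \<cdot> t) \<oplus> [(4 * (v * (1 - 2 * j)))] \<cdot> t
        = [((4 * v - 2 * u) * (1 - 2 * j))] \<cdot> t"
      using t by (simp add: smult_smult add_smult[symmetric] algebra_simps)
    finally show ?thesis using sA by (auto simp: smult_smult)
  qed
  have t_nt: "\<not> torsion A t"
  proof
    assume "torsion A t"
    moreover obtain m :: int where "[(- 8::int)] \<cdot> s0 = [(m * (1 - 2 * 0))] \<cdot> t" using key[OF s0(1)] by blast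
    ultimately have "torsion A ([(- 8::int)] \<cdot> s0)" using torsion_smult[OF t(1)] by simp
    then show False using torsion_of_smult[OF Soc_closed[OF s0(1)], of "- 8"] s0(2) by auto
  qed
  obtain m :: int where "[(- 8::int)] \<cdot> t = [(m * (1 - 2 * 2))] \<cdot> t" using key[OF t(2)] by blast
  then have "- 8 = m * (1 - 2 * 2)" by (rule not_torsion_smult_eq[OF t(1) t_nt])
  then show False by presburger
qed

end

section \<open>The star operation of a non-periodic brace\<close>

locale nonperiodic_dedekind_soc2 = dedekind_soc2 +
  assumes nonperiodic: "\<exists>a \<in> carrier A. \<not> torsion A a"
begin

lemma Soc_not_torsion_ex:
  obtains s0 where "s0 \<in> Soc A" "\<not> torsion A s0"
  using nonperiodic Soc_not_torsion by blast

lemma lam_Soc: 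
  assumes "b \<in> carrier A" "s \<in> Soc A"
  shows "lam A b s = s"
proof -
  obtain s0 where s0: "s0 \<in> Soc A" "\<not> torsion A s0" by (rule Soc_not_torsion_ex)
  obtain k :: int where k: "k = 1 \<or> k = - 1" "\<And>s. s \<in> Soc A \<Longrightarrow> lam A b s = [k] \<cdot> s"
    using lam_Soc_sign[OF assms(1) s0] by blast
  have "k \<noteq> - 1"
  proof
    assume "k = - 1"
    then have "lam A b s = \<ominus> s" if "s \<in> Soc A" for s
      using k(2)[OF that] Soc_closed[OF that] by (simp add: neg_smult)
    then show False by (rule lam_Soc_not_inversion[OF assms(1) s0])
  qed
  then show ?thesis using k assms Soc_closed by simp
qed

lemma star_Soc_right: "\<lbrakk>b \<in> carrier A; s \<in> Soc A\<rbrakk> \<Longrightarrow> star A b s = \<zero>"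
  by (simp add: star_eq Soc_closed lam_Soc minus_eq_zero_iff)

lemma star_Soc_left: "\<lbrakk>s \<in> Soc A; b \<in> carrier A\<rbrakk> \<Longrightarrow> star A s b = \<zero>"
  by (simp add: Soc_def)

lemma Soc_central: "Soc A \<subseteq> brace_centre A"
  unfolding brace_centre_def by (auto simp: Soc_closed Soc_mult mult_eq_add_lam lam_Soc a_comm)

lemma star_add_left:
  assumes "a \<in> carrier A" "b \<in> carrier A" "c \<in> carrier A"
  shows "star A (a \<oplus> b) c = star A a c \<oplus> star A b c"
proof -
  have "c \<oplus> star A (a \<oplus> b) c = lam A a (c \<oplus> star A b c)"
    using assms by (simp add: lam_add_left flip: lam_eq_add_star)
  also have "\<dots> = (c \<oplus> star A a c) \<oplus> star A b c"
    using assms by (simp add: lam_add star_closed lam_Soc star_Soc) (simp add: lam_eq_add_star)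
  finally show ?thesis using assms by (simp add: star_closed a_assoc)
qed

lemma star_add_right:
  assumes "a \<in> carrier A" "b \<in> carrier A" "c \<in> carrier A"
  shows "star A c (a \<oplus> b) = star A c a \<oplus> star A c b"
  using assms by (simp add: star_eq lam_add a_minus_def lam_closed minus_add a_ac)

lemma star_smult_left:
  assumes "a \<in> carrier A" "c \<in> carrier A"
  shows "star A ([(k::int)] \<cdot> a) c = [k] \<cdot> star A a c"
proof -
  have "(\<lambda>a. star A a c) \<in> hom (add_monoid A) (add_monoid A)"
    using assms by (simp add: hom_def star_closed star_add_left)
  then show ?thesis
    using hom_int_pow[OF _ _ a_group a_group, of "\<lambda>a. star A a c" a k] assms(1)
    by (simp add: add_pow_def)
qed

text \<open>
If \<open>t = a \<ast> a\<close> had infinite order, consider \<open>x = 2a\<close>. Then \<open>x \<ast> a = 2t\<close> lies in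
\<open>\<int>x + \<int>(x \<ast> x) = \<int>2a + \<int>4t\<close>. Taking the star product with \<open>a\<close> shows that the coefficient
of \<open>2a\<close> is zero, so \<open>2t \<in> \<int>4t\<close>, which is absurd.
\<close>
lemma torsion_star_self:
  assumes a: "a \<in> carrier A"
  shows "torsion A (star A a a)"
proof (rule ccontr)
  assume nt: "\<not> torsion A (star A a a)"
  let ?t = "star A a a" and ?x = "[(2::int)] \<cdot> a"
  note t = star_closed[OF a a]
  have x: "?x = a \<oplus> a" "?x \<in> carrier A" using add_smult[OF a, of 1 1] a by simp_all
  have xa: "star A ?x a = [(2::int)] \<cdot> ?t" using a by (simp add: star_smult_left)
  have xx: "star A ?x ?x = [(4::int)] \<cdot> ?t"
  proof -
    have "star A ?x ?x = star A ?x a \<oplus> star A ?x a"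
      using a x(2) by (subst (2) x(1)) (simp add: star_add_right)
    then show ?thesis using add_smult[OF t, of 2 2] by (simp add: xa)
  qed
  obtain u v :: int where uv: "star A ?x a = [u] \<cdot> ?x \<oplus> [v] \<cdot> star A ?x ?x"
    using star_in_cyclic_hull(1)[OF x(2) a] by (rule cyclic_hullE)
  have "[(0::int)] \<cdot> ?t = star A (star A ?x a) a"
    using a x(2) by (simp add: star_Soc_left star_Soc zero_smult)
  also have "\<dots> = star A ([u] \<cdot> ?x \<oplus> [v] \<cdot> star A ?x ?x) a"
    by (rule arg_cong[OF uv])
  also have "\<dots> = [u] \<cdot> star A ?x a \<oplus> [v] \<cdot> star A (star A ?x ?x) a"
    using a x(2) by (simp add: star_add_left star_smult_left smult_closed star_closed)
  also have "\<dots> = [(u * 2)] \<cdot> ?t"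
    using a x(2) t by (simp add: star_Soc_left star_Soc smult_zero xa smult_smult smult_closed)
  finally have "0 = u * 2" by (rule not_torsion_smult_eq[OF t nt])
  then have "[(2::int)] \<cdot> ?t = [(v * 4)] \<cdot> ?t"
    using uv t a by (simp add: xa xx zero_smult smult_smult smult_closed)
  then have "2 = v * 4" by (rule not_torsion_smult_eq[OF t nt])
  then show False by presburger
qed

lemma star_translate:
  assumes "x \<in> carrier A" "y \<in> carrier A" "s \<in> Soc A"
  shows "star A (x \<oplus> s) y = star A x y" "star A y (x \<oplus> s) = star A y x"
  using assms by (simp_all add: star_add_left star_add_right Soc_closed star_Soc_left star_Soc_right star_closed)

text \<open>
Translation by elements of the socle leaves star products unchanged, so \<open>a \<ast> b\<close> lies in
\<open>\<int>(a + s) + \<int>(a \<ast> a)\<close> for every \<open>s\<close> in the socle, and similarly for \<open>b\<close>.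
\<close>
lemma star_mem_multiples:
  assumes a: "a \<in> carrier A" and b: "b \<in> carrier A"
  shows "star A a b \<in> multiples A (star A a a)" "star A a b \<in> multiples A (star A b b)"
proof -
  obtain s0 where s0: "s0 \<in> Soc A" "\<not> torsion A s0" by (rule Soc_not_torsion_ex)
  show "star A a b \<in> multiples A (star A a a)"
  proof (rule mem_multiples_of_translates[OF subgroup_Soc s0 a star_Soc[OF a b] star_closed[OF a a] torsion_star_self[OF a]])
    fix s assume s: "s \<in> Soc A"
    have as: "a \<oplus> s \<in> carrier A" using a s Soc_closed by simp
    have "star A a b = star A (a \<oplus> s) b" "star A (a \<oplus> s) (a \<oplus> s) = star A a a"
      using star_translate[OF a _ s] a b as by simp_all
    then show "\<exists>(u::int) (v::int). star A a b = [u] \<cdot> (a \<oplus> s) \<oplus> [v] \<cdot> star A a a"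
      using star_in_cyclic_hull(1)[OF as b] unfolding cyclic_hull_def by auto
  qed
  show "star A a b \<in> multiples A (star A b b)"
  proof (rule mem_multiples_of_translates[OF subgroup_Soc s0 b star_Soc[OF a b] star_closed[OF b b] torsion_star_self[OF b]])
    fix s assume s: "s \<in> Soc A"
    have bs: "b \<oplus> s \<in> carrier A" using b s Soc_closed by simp
    have "star A a b = star A a (b \<oplus> s)" "star A (b \<oplus> s) (b \<oplus> s) = star A b b"
      using star_translate[OF b _ s] a b bs by simp_all
    then show "\<exists>(u::int) (v::int). star A a b = [u] \<cdot> (b \<oplus> s) \<oplus> [v] \<cdot> star A b b"
      using star_in_cyclic_hull(2)[OF bs a] unfolding cyclic_hull_def by auto
  qed
qed

text \<open>
Let \<open>c \<ast> a = k(a \<ast> a)\<close>. The element \<open>w = c + (1 - k)a\<close> is chosen such that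
\<open>w \<ast> a = a \<ast> a\<close>, so \<open>\<int>(w \<ast> w)\<close> contains \<open>a \<ast> a\<close>. It then contains \<open>a \<ast> c\<close>, which is a
multiple of \<open>a \<ast> a\<close>, and therefore also \<open>c \<ast> c = w \<ast> c - (1 - k)(a \<ast> c)\<close>.
\<close>
lemma star_squares_directed:
  assumes a: "a \<in> carrier A" and c: "c \<in> carrier A"
  shows "\<exists>w \<in> carrier A. star A a a \<in> multiples A (star A w w) \<and> star A c c \<in> multiples A (star A w w)"
proof -
  obtain k :: int where k: "star A c a = [k] \<cdot> star A a a" using star_mem_multiples(2)[OF c a] by (rule multiplesE)
  define w where "w = c \<oplus> [(1 - k)] \<cdot> a"
  have w: "w \<in> carrier A" unfolding w_def using a c by (simp add: smult_closed)
  let ?M = "multiples A (star A w w)"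
  have M: "subgroup ?M (add_monoid A)" using w by (intro subgroup_multiples star_closed)
  have "star A w a = [k] \<cdot> star A a a \<oplus> [(1 - k)] \<cdot> star A a a"
    unfolding w_def using a c by (simp add: star_add_left star_smult_left smult_closed k)
  also have "\<dots> = star A a a" using a star_closed[OF a a] by (simp add: add_smult[symmetric])
  finally have aa: "star A a a \<in> ?M" using star_mem_multiples(1)[OF w a] by simp
  obtain j :: int where j: "star A a c = [j] \<cdot> star A a a" using star_mem_multiples(1)[OF a c] by (rule multiplesE)
  have "star A w c = star A c c \<oplus> [(1 - k)] \<cdot> star A a c"
    unfolding w_def using a c by (simp add: star_add_left star_smult_left smult_closed)
  then have "star A c c = star A w c \<ominus> [(1 - k)] \<cdot> star A a c"
    using a c w star_closed by (simp add: a_minus_def a_assoc r_neg smult_closed)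
  also have "\<dots> \<in> ?M"
    unfolding j by (intro subgroup_minus[OF M] subgroup_smult[OF M] aa star_mem_multiples(1) w c)
  finally show ?thesis using aa w by blast
qed

end

context nonperiodic_dedekind_soc2
begin

abbreviation "star_square \<equiv> star_set A (carrier A) (carrier A)"

lemma subgroup_star_square: "subgroup star_square (add_monoid A)"
  by (intro subgroup_star_set subset_refl)

lemma star_square_subset_Soc: "star_square \<subseteq> Soc A"
  by (rule star_set_minimal[OF subgroup_Soc star_Soc])

lemma star_square_eq: "star_square = (\<Union>w \<in> carrier A. multiples A (star A w w))"
proof
  let ?U = "\<Union>w \<in> carrier A. multiples A (star A w w)"
  have "subgroup ?U (add_monoid A)"
  proof (rule add.subgroupI)
    have mult: "subgroup (multiples A (star A w w)) (add_monoid A)" if "w \<in> carrier A" for w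
      using that by (intro subgroup_multiples star_closed)
    show "?U \<subseteq> carrier A" using subgroup.subset[OF mult] by auto
    show "?U \<noteq> {}" using multiplesI zero_closed by blast
    show "\<ominus> x \<in> ?U" if "x \<in> ?U" for x
      using that subgroup.m_inv_closed[OF mult, folded a_inv_def] by auto
    show "x \<oplus> y \<in> ?U" if xy: "x \<in> ?U" "y \<in> ?U" for x y
    proof -
      obtain a where a: "a \<in> carrier A" "x \<in> multiples A (star A a a)" using xy(1) by (rule UN_E)
      obtain c where c: "c \<in> carrier A" "y \<in> multiples A (star A c c)" using xy(2) by (rule UN_E)
      obtain w where w: "w \<in> carrier A"
        "star A a a \<in> multiples A (star A w w)" "star A c c \<in> multiples A (star A w w)"
        using star_squares_directed[OF a(1) c(1)] by (elim bexE conjE)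
      have "x \<in> multiples A (star A w w)" "y \<in> multiples A (star A w w)"
        using a(2) c(2) multiples_subset[OF mult[OF w(1)] w(2)] multiples_subset[OF mult[OF w(1)] w(3)]
        by blast+
      then have "x \<oplus> y \<in> multiples A (star A w w)" using subgroup.m_closed[OF mult[OF w(1)]] by simp
      then show ?thesis using w(1) by blast
    qed
  qed
  then show "star_square \<subseteq> ?U"
    by (rule star_set_minimal) (use star_mem_multiples(1) in blast)
  show "?U \<subseteq> star_square"
    by (intro UN_least multiples_subset[OF subgroup_star_square] star_setI)
qed

lemma torsion_star_square:
  assumes "x \<in> star_square"
  shows "torsion A x"
proof -
  obtain w where w: "w \<in> carrier A" "x \<in> multiples A (star A w w)"
    using assms unfolding star_square_eq by (rule UN_E)
  obtain k :: int where "x = [k] \<cdot> star A w w" using w(2) by (rule multiplesE)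
  then show ?thesis using w(1) torsion_star_self by (simp add: torsion_smult star_closed)
qed

lemma finite_subset_star_square:
  assumes "finite F" "F \<subseteq> star_square"
  shows "\<exists>g \<in> star_square. F \<subseteq> multiples A g"
proof -
  have "\<exists>w \<in> carrier A. F \<subseteq> multiples A (star A w w)"
    using assms
  proof (induction F rule: finite_induct)
    case empty
    then show ?case using zero_closed by blast
  next
    case (insert x F)
    obtain c where c: "c \<in> carrier A" "F \<subseteq> multiples A (star A c c)"
      using insert.IH insert.prems by blast
    have "x \<in> star_square" using insert.prems by blast
    then obtain a where a: "a \<in> carrier A" "x \<in> multiples A (star A a a)"
      unfolding star_square_eq by (rule UN_E)
    obtain w where w: "w \<in> carrier A"
      "star A a a \<in> multiples A (star A w w)" "star A c c \<in> multiples A (star A w w)"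
      using star_squares_directed[OF a(1) c(1)] by (elim bexE conjE)
    have mult: "subgroup (multiples A (star A w w)) (add_monoid A)"
      using w(1) by (intro subgroup_multiples star_closed)
    show ?case
      using w(1) a(2) c(2) multiples_subset[OF mult w(2)] multiples_subset[OF mult w(3)] by blast
  qed
  then obtain w where "w \<in> carrier A" "F \<subseteq> multiples A (star A w w)" by (elim bexE)
  then show ?thesis using star_setI[of w "carrier A" w "carrier A"] by blast
qed

text \<open>
An exponent that kills \<open>a \<ast> a\<close> kills every \<open>a \<ast> b\<close>, since these are multiples of \<open>a \<ast> a\<close>.
\<close>
lemma multiple_in_Soc:
  assumes a: "a \<in> carrier A"
  shows "\<exists>n::int. n \<noteq> 0 \<and> [n] \<cdot> a \<in> Soc A"
proof -
  note t = star_closed[OF a a]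
  obtain n :: int where n: "n \<noteq> 0" "[n] \<cdot> star A a a = \<zero>"
    using torsion_star_self[OF a] unfolding torsion_def by (elim exE conjE)
  have "star A ([n] \<cdot> a) b = \<zero>" if b: "b \<in> carrier A" for b
  proof -
    obtain k :: int where k: "star A a b = [k] \<cdot> star A a a"
      using star_mem_multiples(1)[OF a b] by (rule multiplesE)
    have "star A ([n] \<cdot> a) b = [k] \<cdot> ([n] \<cdot> star A a a)"
      using a b t by (simp add: star_smult_left k smult_smult mult.commute)
    then show ?thesis by (simp add: n(2) smult_zero)
  qed
  then have "[n] \<cdot> a \<in> Soc A" unfolding Soc_def using a by (simp add: smult_closed)
  with n(1) show ?thesis by blast
qed

end

section \<open>The embedding\<close>

theorem theorem3:
  fixes A :: "('a, 'm) ring_scheme"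
  assumes "dedekind_brace A"
    and "carrier A = Soc2 A"
    and "\<not> periodic_group (add_monoid A)"
  shows "\<exists>(T :: 'a set ring) (D :: 'a set ring) f.
    left_brace T \<and> left_brace D \<and>
    brace_embedding f A (RDirProd T D) \<and>
    dedekind_brace T \<and> periodic_group (add_monoid T) \<and>
    locally_cyclic_group
      ((add_monoid T)\<lparr>carrier := star_set T (carrier T) (carrier T)\<rparr>) \<and>
    star_set T (carrier T) (carrier T) \<subseteq> brace_centre T \<and>
    abelian_brace D"
proof -
  interpret dedekind_soc2 A by (rule dedekind_soc2I[OF assms(1,2)])
  interpret nonperiodic_dedekind_soc2 A
    by unfold_locales (use assms(3) periodic_iff_torsion in blast)
  let ?K = star_square
  \<comment> \<open>Inside the socle every subgroup is an ideal, so the quotient by \<open>M\<close> is a brace.\<close>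
  obtain M where M: "subgroup M (add_monoid A)" "M \<subseteq> Soc A" "M \<inter> ?K = {\<zero>\<^bsub>A\<^esub>}"
    and essential: "\<And>s. s \<in> Soc A \<Longrightarrow> \<exists>n::int. n \<noteq> 0 \<and> [n] \<cdot>\<^bsub>A\<^esub> s \<in> M"
    using exists_maximal_avoiding_torsion[OF subgroup_Soc subgroup_star_square torsion_star_square]
    by metis
  interpret T: brace_quotient A M
    by unfold_locales (intro ideal_of_subbrace subbrace_of_Soc M)
  interpret D: brace_quotient A ?K
    by unfold_locales (intro ideal_of_subbrace subbrace_of_Soc subgroup_star_square star_square_subset_Soc)
  let ?T = "A Quot M" and ?D = "A Quot ?K"
  define f where "f x = (M +>\<^bsub>A\<^esub> x, ?K +>\<^bsub>A\<^esub> x)" for x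
  interpret BT: left_brace ?T by (rule T.proj.left_brace_image)

  have "inj_on f (carrier A)"
  proof (rule inj_onI)
    fix x y assume x: "x \<in> carrier A" and y: "y \<in> carrier A" and "f x = f y"
    then have "x \<ominus>\<^bsub>A\<^esub> y \<in> M \<inter> ?K"
      using T.coset_eq_iff[OF x y] D.coset_eq_iff[OF x y] by (simp add: f_def)
    then show "x = y" using M(3) minus_eq_zero_iff[OF x y] by blast
  qed
  moreover have "f \<in> brace_hom A (RDirProd ?T ?D)"
    unfolding brace_hom_def
  proof
    show "f \<in> hom (add_monoid A) (add_monoid (RDirProd ?T ?D))"
      unfolding RDirProd_add_monoid
      by (auto simp: hom_def f_def T.proj.h_closed D.proj.h_closed T.quot_add D.quot_add)
    show "f \<in> hom A (RDirProd ?T ?D)"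
      unfolding RDirProd_def
      by (auto simp: hom_def f_def monoid.defs DirProd_def
          T.proj.h_closed D.proj.h_closed T.quot_mult D.quot_mult)
  qed
  ultimately have emb: "brace_embedding f A (RDirProd ?T ?D)"
    unfolding brace_embedding_def by blast

  \<comment> \<open>All conditions on \<open>T \<ast> T\<close> are transported from \<open>A \<ast> A\<close> along the projection.\<close>
  have TT: "star_set ?T (carrier ?T) (carrier ?T) = (+>\<^bsub>A\<^esub>) M ` ?K"
    using T.proj.star_set_image[of "carrier A" "carrier A"] by (simp add: T.quot_carrier)

  have "torsion ?T x" if "x \<in> carrier ?T" for x
  proof -
    obtain a where a: "a \<in> carrier A" "x = M +>\<^bsub>A\<^esub> a"
      using \<open>x \<in> carrier ?T\<close> unfolding T.quot_carrier by (elim imageE)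
    obtain n :: int where n: "n \<noteq> 0" "[n] \<cdot>\<^bsub>A\<^esub> a \<in> Soc A" using multiple_in_Soc[OF a(1)] by (elim exE conjE)
    obtain m :: int where m: "m \<noteq> 0" "[m] \<cdot>\<^bsub>A\<^esub> ([n] \<cdot>\<^bsub>A\<^esub> a) \<in> M" using essential[OF n(2)] by (elim exE conjE)
    have mn: "[(m * n)] \<cdot>\<^bsub>A\<^esub> a \<in> M" using m(2) by (simp add: smult_smult[OF a(1)])
    have "[(m * n)] \<cdot>\<^bsub>?T\<^esub> x = M +>\<^bsub>A\<^esub> ([(m * n)] \<cdot>\<^bsub>A\<^esub> a)" using a by (simp add: T.proj.h_smult)
    also have "\<dots> = \<zero>\<^bsub>?T\<^esub>" using mn T.coset_eq_zero_iff[OF smult_closed[OF a(1)]] by blast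
    finally have "[(m * n)] \<cdot>\<^bsub>?T\<^esub> x = \<zero>\<^bsub>?T\<^esub>" .
    then show ?thesis unfolding torsion_def using m(1) n(1) by (intro exI[of _ "m * n"]) simp
  qed
  then have per: "periodic_group (add_monoid ?T)" using BT.periodic_iff_torsion by blast

  have cyc: "locally_cyclic_group ((add_monoid ?T)\<lparr>carrier := star_set ?T (carrier ?T) (carrier ?T)\<rparr>)"
  proof (rule BT.locally_cyclic_subgroupI)
    show "subgroup (star_set ?T (carrier ?T) (carrier ?T)) (add_monoid ?T)"
      by (intro BT.subgroup_star_set subset_refl)
    fix F assume "finite F" "F \<subseteq> star_set ?T (carrier ?T) (carrier ?T)"
    then obtain E where E: "finite E" "E \<subseteq> ?K" "F = (+>\<^bsub>A\<^esub>) M ` E"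
      unfolding TT by (meson finite_subset_image)
    obtain g where g: "g \<in> ?K" "E \<subseteq> multiples A g" using finite_subset_star_square[OF E(1,2)] by (elim bexE)
    have "g \<in> carrier A" using g(1) star_square_subset_Soc Soc_closed by blast
    then have "F \<subseteq> multiples ?T (M +>\<^bsub>A\<^esub> g)"
      unfolding E(3) using g(2) by (auto simp: multiples_def T.proj.h_smult)
    then show "\<exists>g \<in> star_set ?T (carrier ?T) (carrier ?T). F \<subseteq> multiples ?T g"
      unfolding TT using g(1) by blast
  qed

  have cen: "star_set ?T (carrier ?T) (carrier ?T) \<subseteq> brace_centre ?T"
    unfolding TT using star_square_subset_Soc Soc_central T.proj.brace_centre_image by blast

  have "star ?D x y = \<zero>\<^bsub>?D\<^esub>" if "x \<in> carrier ?D" "y \<in> carrier ?D" for x y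
  proof -
    obtain a where a: "a \<in> carrier A" "x = ?K +>\<^bsub>A\<^esub> a"
      using \<open>x \<in> carrier ?D\<close> unfolding D.quot_carrier by (elim imageE)
    obtain b where b: "b \<in> carrier A" "y = ?K +>\<^bsub>A\<^esub> b"
      using \<open>y \<in> carrier ?D\<close> unfolding D.quot_carrier by (elim imageE)
    have "star ?D x y = ?K +>\<^bsub>A\<^esub> star A a b" using a b by (simp add: D.proj.h_star)
    also have "\<dots> = \<zero>\<^bsub>?D\<^esub>"
      using star_setI[OF a(1) b(1)] D.coset_eq_zero_iff[OF star_closed[OF a(1) b(1)]] by blast
    finally show ?thesis .
  qed
  then have "abelian_brace ?D" unfolding abelian_brace_def using D.proj.left_brace_image by blast
  moreover have "dedekind_brace ?T" by (rule T.proj.dedekind_image[OF assms(1)])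
  ultimately show ?thesis
    using emb per cyc cen T.proj.left_brace_image D.proj.left_brace_image
    by (intro exI[of _ ?T] exI[of _ ?D] exI[of _ f]) blast
qed

end
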